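(* Let $q\geq 5$ be a prime power with $q\equiv 2\pmod 3$ and let $P\in\mathcal O$ be a point of $\mathcal X_3$. Then the Weierstrass semigroup at $P$ is $H(P)=\langle q-2,\,q,\,q+1\rangle$.
   Context: Let $q$ be a prime power with $q\equiv 2\pmod 3$ and put $m=(q+1)/3$. Let $\mathcal X_3$ be the nonsingular projective model (defined over $\mathbb F_{q^2}$) of the plane curve $y^{q+1}+x^{2m}+x^m=0$; its function field is $\mathbb F_{q^2}(x,y)$ with this relation. There are exactly $m$ points of $\mathcal X_3$ centered at the singular point $(0,0)$ (the zeros of $x$); call this set $\mathcal O_0$. There are exactly $m$ points lying over the point at infinity of the plane curve (the poles of $x$); call this set $\mathcal O_\infty$. Every other point has affine coordinates $(a,b)$ with $a\neq 0$ and is denoted $P_{(a,b)}$. Let $\mathcal O_m=\{P_{(a,0)} : a^m+1=0\}$ and $\mathcal O=\mathcal O_0\cup\mathcal O_\infty\cup\mathcal O_m$. For a point $P$, the Weierstrass semigroup $H(P)$ is the set of integers $n\geq 0$ for which there is a function $f$ on $\mathcal X_3$ with pole divisor exactly $nP$; $\langle\cdot\rangle$ denotes the numerical semigroup generated by the listed integers. *)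

theory Defs
  imports Main "HOL-Computational_Algebra.Polynomial" "HOL-Computational_Algebra.Primes"
begin

definition prime_power_nat :: "nat \<Rightarrow> bool" where
  "prime_power_nat q \<longleftrightarrow> (\<exists>p k. prime p \<and> k > 0 \<and> q = p ^ k)"

definition is_subfield :: "'k::field set \<Rightarrow> bool" where
  "is_subfield S \<longleftrightarrow> 0 \<in> S \<and> 1 \<in> S \<and>
     (\<forall>a\<in>S. \<forall>b\<in>S. a + b \<in> S \<and> a * b \<in> S) \<and>
     (\<forall>a\<in>S. - a \<in> S \<and> inverse a \<in> S)"

definition transcendental_over :: "'k::field set \<Rightarrow> 'k \<Rightarrow> bool" where
  "transcendental_over F x \<longleftrightarrow>
     (\<forall>p::'k poly. p \<noteq> 0 \<longrightarrow> (\<forall>i. coeff p i \<in> F) \<longrightarrow> poly p x \<noteq> 0)"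

definition generated_by :: "'k::field set \<Rightarrow> 'k \<Rightarrow> 'k \<Rightarrow> bool" where
  "generated_by F x y \<longleftrightarrow>
     (\<forall>S. is_subfield S \<and> F \<subseteq> S \<and> x \<in> S \<and> y \<in> S \<longrightarrow> S = UNIV)"

text \<open>Places of the function field 'k / F, represented by their normalized discrete
  valuations v (value at 0 fixed to 0 by convention; it plays no role).\<close>
definition place :: "'k::field set \<Rightarrow> ('k \<Rightarrow> int) \<Rightarrow> bool" where
  "place F v \<longleftrightarrow> v 0 = 0 \<and> surj v \<and>
     (\<forall>a b. a \<noteq> 0 \<longrightarrow> b \<noteq> 0 \<longrightarrow> v (a * b) = v a + v b) \<and>
     (\<forall>a b. a \<noteq> 0 \<longrightarrow> b \<noteq> 0 \<longrightarrow> a + b \<noteq> 0 \<longrightarrow> min (v a) (v b) \<le> v (a + b)) \<and>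
     (\<forall>c\<in>F. c \<noteq> 0 \<longrightarrow> v c = 0)"

definition weierstrass_semigroup :: "'k::field set \<Rightarrow> ('k \<Rightarrow> int) \<Rightarrow> nat set" where
  "weierstrass_semigroup F P = {n. \<exists>f. f \<noteq> 0 \<and> P f = - int n \<and>
       (\<forall>Q. place F Q \<and> Q \<noteq> P \<longrightarrow> Q f \<ge> 0)}"

definition O_zero :: "'k::field set \<Rightarrow> 'k \<Rightarrow> ('k \<Rightarrow> int) set" where
  "O_zero F x = {P. place F P \<and> P x > 0}"

definition O_infty :: "'k::field set \<Rightarrow> 'k \<Rightarrow> ('k \<Rightarrow> int) set" where
  "O_infty F x = {P. place F P \<and> P x < 0}"

definition O_m :: "'k::field set \<Rightarrow> nat \<Rightarrow> 'k \<Rightarrow> 'k \<Rightarrow> ('k \<Rightarrow> int) set" where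
  "O_m F m x y = {P. place F P \<and>
      (\<exists>a\<in>F. a ^ m + 1 = 0 \<and> P (x - a) > 0 \<and> P y > 0)}"

definition O_set :: "'k::field set \<Rightarrow> nat \<Rightarrow> 'k \<Rightarrow> 'k \<Rightarrow> ('k \<Rightarrow> int) set" where
  "O_set F m x y = O_zero F x \<union> O_infty F x \<union> O_m F m x y"

end

theory Submission
  imports Defs
begin

text \<open>Write n = q + 1 = 3m and w = y^3/x. The equation becomes w^m + x^m + 1 = 0 with y^3 = xw, which
  is symmetric enough to replace (x, y) by (1/x, y/x) or (w, y) and so to assume that P is a zero
  of x. Then w - c vanishes at P to order n for some c in F, and P is the only place above w = c.
  With f = 1/(w - c), the functions xf, yf and f are regular off P and have pole orders q - 2, q and
  q + 1 there.

  Conversely, K is the Kummer extension of W = F(w) with basis y^i, i < n. The automorphisms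
  y \<mapsto> zy with z^n = 1 fix P and permute the other places, so each term b_i y^i of a function
  regular off P is itself regular off P. The terms have distinct orders at P, hence the pole order is
  that of a single term. For i = 3s + k with k < 3, the quotient z of b_i y^i by (xf)^s (yf)^k lies
  in W; at every other place over w = 0, w = infinity or w^m = -1 its value is both a multiple of
  the ramification index and larger than minus that index, so z is regular off P. A
  function with a zero has a pole, so the order of z at P is a nonpositive multiple of n. That such a
  pole exists among the discrete places is obtained from Zorn's lemma and the finiteness of
  K over W.\<close>

section \<open>Subrings, polynomials and rational functions\<close>

text \<open>A place here may have any degree over the finite field F, so residues need not lie in F.
  Where a residue in F is needed, it comes from w^m + 1 dividing w^(q^2) - w, which splits into
  linear factors over F. Since n = q + 1 divides q^2 - 1, all n-th roots of unity lie in F, and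
  since q = 0 in K, the averaging over them needs no correction factor.

  The generators come from the orders of x, y and w - c at P, which are 3, 1 and n: dividing by w -
  c turns x, y and 1 into pole orders n - 3, n - 1 and n.

  Total ramification above w = c does the work of the irreducibility of the Kummer equation: the
  terms b_i y^i have values that differ modulo n, which gives the independence of the powers of y,
  the uniqueness of P and the absence of cancellation at once.

  Zorn's lemma alone yields a valuation ring with an unknown value group. It is discrete because
  F[w] (or F[1/w]) has division with remainder, and because every element of K satisfies a relation
  of degree at most n over W, so that a single exponent n! brings all values down to W.\<close>

definition subring_of :: "'k::field set \<Rightarrow> bool" where
  "subring_of A \<longleftrightarrow> 0 \<in> A \<and> 1 \<in> A \<and>
     (\<forall>a\<in>A. \<forall>b\<in>A. a + b \<in> A \<and> a * b \<in> A) \<and> (\<forall>a\<in>A. - a \<in> A)"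

definition polys :: "'k::field set \<Rightarrow> 'k poly set" where
  "polys A = {p. \<forall>i. coeff p i \<in> A}"

definition adjoin :: "'k::field set \<Rightarrow> 'k \<Rightarrow> 'k set" where
  "adjoin A z = (\<lambda>p. poly p z) ` polys A"

text \<open>This is F(w). A pair with \<open>poly r w = 0\<close> adds nothing, since the quotient
  is then 0.\<close>

definition ratfuns :: "'k::field set \<Rightarrow> 'k \<Rightarrow> 'k set" where
  "ratfuns F w = {poly p w / poly r w | p r. p \<in> polys F \<and> r \<in> polys F}"

lemma subfield_subring: "is_subfield S \<Longrightarrow> subring_of S"
  by (simp add: is_subfield_def subring_of_def)

lemma subringD:
  assumes "subring_of A"
  shows subring_0: "0 \<in> A" and subring_1: "1 \<in> A"
    and subring_add: "\<And>a b. a \<in> A \<Longrightarrow> b \<in> A \<Longrightarrow> a + b \<in> A"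
    and subring_mult: "\<And>a b. a \<in> A \<Longrightarrow> b \<in> A \<Longrightarrow> a * b \<in> A"
    and subring_uminus: "\<And>a. a \<in> A \<Longrightarrow> - a \<in> A"
  using assms by (auto simp: subring_of_def)

lemma subring_diff: "subring_of A \<Longrightarrow> a \<in> A \<Longrightarrow> b \<in> A \<Longrightarrow> a - b \<in> A"
  using subring_add[of A a "-b"] subring_uminus[of A b] by simp

lemma subring_sum:
  "subring_of A \<Longrightarrow> (\<And>i. i \<in> I \<Longrightarrow> f i \<in> A) \<Longrightarrow> sum f I \<in> A"
  by (induction I rule: infinite_finite_induct) (auto intro: subringD)

lemma subring_power: "subring_of A \<Longrightarrow> a \<in> A \<Longrightarrow> a ^ k \<in> A"
  by (induction k) (auto intro: subringD)

lemma subfield_divide: "is_subfield S \<Longrightarrow> a \<in> S \<Longrightarrow> b \<in> S \<Longrightarrow> a / b \<in> S"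
  by (simp add: is_subfield_def divide_inverse)

lemma polys_coeff: "p \<in> polys A \<Longrightarrow> coeff p i \<in> A"
  by (simp add: polys_def)

lemma polys_pCons: "a \<in> A \<Longrightarrow> p \<in> polys A \<Longrightarrow> pCons a p \<in> polys A"
  by (auto simp: polys_def coeff_pCons split: nat.splits)

lemma polys_pConsD: "pCons a p \<in> polys A \<Longrightarrow> a \<in> A \<and> p \<in> polys A"
  unfolding polys_def mem_Collect_eq by (metis coeff_pCons_0 coeff_pCons_Suc)

lemma polysI:
  assumes "subring_of A"
  shows polys_0: "0 \<in> polys A"
    and polys_const: "\<And>a. a \<in> A \<Longrightarrow> [:a:] \<in> polys A"
    and polys_add: "\<And>p r. p \<in> polys A \<Longrightarrow> r \<in> polys A \<Longrightarrow> p + r \<in> polys A"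
    and polys_mult: "\<And>p r. p \<in> polys A \<Longrightarrow> r \<in> polys A \<Longrightarrow> p * r \<in> polys A"
    and polys_uminus: "\<And>p. p \<in> polys A \<Longrightarrow> - p \<in> polys A"
    and polys_diff: "\<And>p r. p \<in> polys A \<Longrightarrow> r \<in> polys A \<Longrightarrow> p - r \<in> polys A"
    and polys_smult: "\<And>a p. a \<in> A \<Longrightarrow> p \<in> polys A \<Longrightarrow> smult a p \<in> polys A"
    and polys_monom: "\<And>a i. a \<in> A \<Longrightarrow> monom a i \<in> polys A"
  using assms
  by (auto simp: polys_def coeff_mult coeff_pCons coeff_monom
      intro!: subringD subring_sum subring_diff split: nat.splits)

lemma polys_sum:
  "subring_of A \<Longrightarrow> (\<And>i. i \<in> I \<Longrightarrow> p i \<in> polys A) \<Longrightarrow> sum p I \<in> polys A"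
  by (induction I rule: infinite_finite_induct) (auto intro: polysI)

lemma polys_mono: "A \<subseteq> B \<Longrightarrow> polys A \<subseteq> polys B"
  by (auto simp: polys_def)

lemma poly_in_subring:
  "subring_of A \<Longrightarrow> p \<in> polys A \<Longrightarrow> z \<in> A \<Longrightarrow> poly p z \<in> A"
  by (auto simp: poly_altdef polys_def intro!: subring_sum subring_mult subring_power)

lemma subring_adjoin:
  assumes A: "subring_of A"
  shows "subring_of (adjoin A z)"
proof -
  have "0 \<in> adjoin A z"
    unfolding adjoin_def by (rule image_eqI[of _ _ 0]) (auto intro: polysI A)
  moreover have "1 \<in> adjoin A z"
    unfolding adjoin_def by (rule image_eqI[of _ _ "[:1:]"]) (auto intro: polysI A subring_1)
  moreover have "poly p z + poly r z \<in> adjoin A z" "poly p z * poly r z \<in> adjoin A z"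
    "- poly p z \<in> adjoin A z" if "p \<in> polys A" "r \<in> polys A" for p r
    unfolding adjoin_def using that A
    by (rule_tac image_eqI[of _ _ "p + r"] image_eqI[of _ _ "p * r"] image_eqI[of _ _ "- p"];
        simp add: polysI)+
  ultimately show ?thesis
    by (auto simp: subring_of_def adjoin_def)
qed

lemma adjoin_subset: "subring_of A \<Longrightarrow> A \<subseteq> adjoin A z"
  by (auto simp: adjoin_def intro!: image_eqI[of _ _ "[:_:]"] polysI)

lemma adjoin_mem: "subring_of A \<Longrightarrow> z \<in> adjoin A z"
  by (auto simp: adjoin_def intro!: image_eqI[of _ _ "[:0, 1:]"] polys_pCons polysI subringD)

lemma ratfunsI:
  "p \<in> polys F \<Longrightarrow> r \<in> polys F \<Longrightarrow> a = poly p w / poly r w \<Longrightarrow> a \<in> ratfuns F w"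
  by (auto simp: ratfuns_def)

lemma ratfuns_poly: "is_subfield F \<Longrightarrow> p \<in> polys F \<Longrightarrow> poly p w \<in> ratfuns F w"
  by (rule ratfunsI[of p _ "[:1:]"]) (auto intro!: polysI dest: subfield_subring subring_1)

lemma ratfuns_const: "is_subfield F \<Longrightarrow> a \<in> F \<Longrightarrow> a \<in> ratfuns F w"
  using ratfuns_poly[of F "[:a:]" w] by (simp add: polysI subfield_subring)

lemma ratfuns_gen: "is_subfield F \<Longrightarrow> w \<in> ratfuns F w"
  using ratfuns_poly[of F "[:0,1:]" w]
  by (simp add: polysI polys_pCons subfield_subring subringD)

lemma subfield_ratfuns:
  assumes F: "is_subfield F"
  shows "is_subfield (ratfuns F w)"
proof -
  note A = subfield_subring[OF F]
  let ?R = "ratfuns F w"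
  have mult: "a * b \<in> ?R" and inv: "inverse a \<in> ?R" and um: "- a \<in> ?R"
    and add: "a + b \<in> ?R" if ab: "a \<in> ?R" "b \<in> ?R" for a b
  proof -
    obtain p r where a: "a = poly p w / poly r w" "p \<in> polys F" "r \<in> polys F"
      using ab(1) by (auto simp: ratfuns_def)
    obtain p' r' where b: "b = poly p' w / poly r' w" "p' \<in> polys F" "r' \<in> polys F"
      using ab(2) by (auto simp: ratfuns_def)
    show "a * b \<in> ?R"
      by (rule ratfunsI[of "p * p'" _ "r * r'"]) (use a b A in \<open>auto intro: polysI\<close>)
    show "inverse a \<in> ?R"
      by (rule ratfunsI[of r _ p]) (use a in auto)
    show "- a \<in> ?R"
      by (rule ratfunsI[of "- p" _ r]) (use a A in \<open>auto intro: polysI\<close>)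
    show "a + b \<in> ?R"
    \<comment> \<open>A vanishing denominator makes that summand 0, and the sum is the other
      summand.\<close>
    proof (cases "poly r w = 0 \<or> poly r' w = 0")
      case True
      then show ?thesis using a b ab by auto
    next
      case False
      then have "a + b = poly (p * r' + p' * r) w / poly (r * r') w"
        unfolding a(1) b(1) by (simp add: add_frac_eq mult.commute)
      then show ?thesis
        by (rule ratfunsI[of "p * r' + p' * r" _ "r * r'", rotated 2])
          (use a b A in \<open>auto intro!: polysI\<close>)
    qed
  qed
  then show ?thesis
    using ratfuns_const[OF F, of _ w] A[THEN subring_0] A[THEN subring_1]
    unfolding is_subfield_def by auto
qed

lemma ratfuns_subset:
  assumes S: "is_subfield S" "F \<subseteq> S" "w \<in> S"
  shows "ratfuns F w \<subseteq> S"
  using polys_mono[OF S(2)] S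
  by (auto simp: ratfuns_def intro!: subfield_divide poly_in_subring subfield_subring)

text \<open>Gaussian elimination: a pivot row \<open>j0\<close> clears the last column, and a
  relation among the reduced rows lifts to all rows. Indexing the vectors by \<open>J\<close> admits
  repetitions, which can occur among the powers of an element.\<close>

lemma subfield_dependent:
  fixes u :: "'i \<Rightarrow> 'k::field"
  assumes W: "is_subfield W" and "finite J" and "card J > n"
    and "\<And>j. j \<in> J \<Longrightarrow> u j = (\<Sum>i<n. A j i * e i)" and "\<And>j i. j \<in> J \<Longrightarrow> i < n \<Longrightarrow> A j i \<in> W"
  shows "\<exists>c. (\<forall>j\<in>J. c j \<in> W) \<and> (\<exists>j\<in>J. c j \<noteq> 0) \<and> (\<Sum>j\<in>J. c j * u j) = 0"
  using assms(2-)
proof (induction n arbitrary: J u A)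
  case 0
  then have "J \<noteq> {}" by auto
  then show ?case
    using 0 subring_1[OF subfield_subring[OF W]] by (intro exI[of _ "\<lambda>_. 1"]) auto
next
  case (Suc n)
  note R = subfield_subring[OF W]
  show ?case
  proof (cases "\<forall>j\<in>J. A j n = 0")
    case True
    then show ?thesis using Suc.prems by (intro Suc.IH[of J u A]) auto
  next
    case False
    then obtain j0 where j0: "j0 \<in> J" "A j0 n \<noteq> 0" by auto
    define J' where "J' = J - {j0}"
    define l where "l j = A j n / A j0 n" for j
    have l: "l j \<in> W" if "j \<in> J" for j
      using that j0 Suc.prems(4) W by (auto simp: l_def intro: subfield_divide)
    have "\<exists>c. (\<forall>j\<in>J'. c j \<in> W) \<and> (\<exists>j\<in>J'. c j \<noteq> 0) \<and> (\<Sum>j\<in>J'. c j * (u j - l j * u j0)) = 0"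
    proof (rule Suc.IH[of J' _ "\<lambda>j i. A j i - l j * A j0 i"])
      show "finite J'" "n < card J'" using Suc.prems j0 by (auto simp: J'_def)
      fix j assume j: "j \<in> J'"
      show "u j - l j * u j0 = (\<Sum>i<n. (A j i - l j * A j0 i) * e i)"
        using j j0 Suc.prems(3)[of j] Suc.prems(3)[of j0]
        by (simp add: J'_def l_def algebra_simps sum_subtractf sum_distrib_left)
      show "A j i - l j * A j0 i \<in> W" if "i < n" for i
        using that j j0 Suc.prems(4) l R
        by (auto simp: J'_def intro!: subring_diff subring_mult)
    qed
    then obtain c where c: "\<forall>j\<in>J'. c j \<in> W" "\<exists>j\<in>J'. c j \<noteq> 0"
      "(\<Sum>j\<in>J'. c j * (u j - l j * u j0)) = 0" by blast
    \<comment> \<open>The pivot row receives the total of what was subtracted from the other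
      rows.\<close>
    define c' where "c' = c(j0 := - (\<Sum>j\<in>J'. c j * l j))"
    have J: "J = insert j0 J'" "j0 \<notin> J'" "finite J'"
      using j0 Suc.prems by (auto simp: J'_def)
    have eq: "(\<Sum>j\<in>J'. c' j * u j) = (\<Sum>j\<in>J'. c j * u j)"
      using J by (intro sum.cong) (auto simp: c'_def)
    have "(\<Sum>j\<in>J. c' j * u j) = (\<Sum>j\<in>J'. c j * (u j - l j * u j0))"
      using J eq
      by (simp add: c'_def algebra_simps sum_subtractf sum_distrib_left)
    moreover have "c' j \<in> W" if "j \<in> J" for j
      using that J c(1) l R
      by (auto simp: c'_def intro!: subring_uminus subring_sum subring_mult)
    moreover have "\<exists>j\<in>J. c' j \<noteq> 0"
      using c(2) J by (metis c'_def fun_upd_other insertCI)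
    ultimately show ?thesis
      using c(3) by (intro exI[of _ c']) auto
  qed
qed

section \<open>Places\<close>

lemma place_mult: "place F v \<Longrightarrow> a \<noteq> 0 \<Longrightarrow> b \<noteq> 0 \<Longrightarrow> v (a * b) = v a + v b"
  by (simp add: place_def)

lemma place_0 [simp]: "place F v \<Longrightarrow> v 0 = 0"
  by (simp add: place_def)

lemma place_const: "place F v \<Longrightarrow> c \<in> F \<Longrightarrow> v c = 0"
  by (cases "c = 0") (auto simp: place_def)

lemma place_1 [simp]: "place F v \<Longrightarrow> v 1 = 0"
  using place_mult[of F v 1 1] by simp

lemma place_uminus: assumes "place F v" shows "v (- a) = v a"
proof (cases "a = 0")
  case False
  have "v (-1) = 0" using place_mult[OF assms, of "-1" "-1"] assms by simp
  then show ?thesis using False place_mult[OF assms, of "-1" a] by simp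
qed simp

lemma place_inverse: assumes "place F v" shows "v (inverse a) = - v a"
  using assms place_mult[OF assms, of a "inverse a"] by (cases "a = 0") auto

lemma place_divide: "place F v \<Longrightarrow> a \<noteq> 0 \<Longrightarrow> b \<noteq> 0 \<Longrightarrow> v (a / b) = v a - v b"
  by (simp add: divide_inverse place_mult place_inverse)

lemma place_power: "place F v \<Longrightarrow> v (a ^ k) = int k * v a"
  by (cases "a = 0"; induction k) (auto simp: place_mult power_0_left algebra_simps)

lemma place_add: "place F v \<Longrightarrow> a \<noteq> 0 \<Longrightarrow> b \<noteq> 0 \<Longrightarrow> a + b \<noteq> 0 \<Longrightarrow> min (v a) (v b) \<le> v (a + b)"
  by (simp add: place_def)

lemma place_add_nonneg: "place F v \<Longrightarrow> v a \<ge> 0 \<Longrightarrow> v b \<ge> 0 \<Longrightarrow> v (a + b) \<ge> 0"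
  using place_add[of F v a b]
  by (cases "a = 0"; cases "b = 0"; cases "a + b = 0") auto

lemma place_mult_nonneg: "place F v \<Longrightarrow> v a \<ge> 0 \<Longrightarrow> v b \<ge> 0 \<Longrightarrow> v (a * b) \<ge> 0"
  by (cases "a = 0"; cases "b = 0") (auto simp: place_mult)

lemma place_sum_nonneg: "place F v \<Longrightarrow> (\<And>i. i \<in> I \<Longrightarrow> v (f i) \<ge> 0) \<Longrightarrow> v (sum f I) \<ge> 0"
  by (induction I rule: infinite_finite_induct) (auto intro: place_add_nonneg)

text \<open>The reverse inequality comes from a = (a + b) + (-b). The case b = 0 is listed
  separately because the value of 0 is 0 by convention, not infinity.\<close>

lemma place_add_eq:
  assumes v: "place F v" and "a \<noteq> 0" and "b = 0 \<or> v a < v b"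
  shows "a + b \<noteq> 0" "v (a + b) = v a"
proof -
  show nz: "a + b \<noteq> 0"
  proof
    assume "a + b = 0"
    then have "a = - b" by (simp add: eq_neg_iff_add_eq_0)
    then show False using assms place_uminus[OF v, of b] by auto
  qed
  show "v (a + b) = v a"
  proof (cases "b = 0")
    case False
    have "min (v a) (v b) \<le> v (a + b)"
      using place_add[OF v, of a b] assms False nz by auto
    moreover have "min (v (a + b)) (v (- b)) \<le> v a"
      using place_add[OF v, of "a + b" "- b"] assms False nz by auto
    ultimately show ?thesis using assms False place_uminus[OF v, of b] by auto
  qed simp
qed

text \<open>The minimal term dominates. The factor \<open>e\<close> is there so that one function
  \<open>k\<close> serves all places above w = c, with e = Q y not yet known to be 1.\<close>

lemma place_sum_distinct:
  fixes k :: "'i \<Rightarrow> int"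
  assumes v: "place F v" and I: "finite I" "I \<noteq> {}" "inj_on k I" and e: "e > 0"
    and t: "\<And>i. i \<in> I \<Longrightarrow> t i \<noteq> 0 \<and> v (t i) = e * k i"
  shows "sum t I \<noteq> 0 \<and> v (sum t I) = e * Min (k ` I)"
  using I t
proof (induction I rule: finite_ne_induct)
  case (insert i I)
  then have IH: "sum t I \<noteq> 0" "v (sum t I) = e * Min (k ` I)" by auto
  have "Min (k ` I) \<in> k ` I" using insert by (intro Min_in) auto
  then obtain i' where "i' \<in> I" "Min (k ` I) = k i'" by auto
  then have ne: "Min (k ` I) \<noteq> k i"
    using insert.prems(1) insert.hyps by (metis inj_on_eq_iff insertCI)
  have m: "Min (k ` insert i I) = min (k i) (Min (k ` I))" using insert by simp
  consider "k i < Min (k ` I)" | "Min (k ` I) < k i" using ne by linarith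
  then show ?case
  proof cases
    case 1
    then have "e * k i < e * Min (k ` I)" using e by simp
    then show ?thesis using place_add_eq[OF v, of "t i" "sum t I"] insert IH 1 m by auto
  next
    case 2
    then have "e * Min (k ` I) < e * k i" using e by simp
    then show ?thesis
      using place_add_eq[OF v, of "sum t I" "t i"] insert IH 2 m by (auto simp: add.commute)
  qed
qed auto

section \<open>Values of polynomials and rational functions in w\<close>

lemma place_poly_nonneg:
  assumes v: "place F v" and "p \<in> polys F" "v w \<ge> 0"
  shows "v (poly p w) \<ge> 0"
  using assms(2)
proof (induction p)
  case (pCons a p)
  then have "a \<in> F" "p \<in> polys F" by (auto dest: polys_pConsD)
  then show ?case
    using pCons.IH v assms(3) by (simp add: place_const place_add_nonneg[OF v] place_mult_nonneg[OF v])
qed (use v in simp)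

lemma polys_synthetic_div:
  assumes A: "subring_of A" and e: "e \<in> A" and "p \<in> polys A"
  shows "synthetic_div p e \<in> polys A"
  using assms(3)
proof (induction p)
  case (pCons a p)
  then have "p \<in> polys A" by (auto dest: polys_pConsD)
  then show ?case using pCons A e by (auto intro!: polys_pCons poly_in_subring)
qed (use A in \<open>auto intro: polysI\<close>)

text \<open>The residue of w is e, so p(w) has residue p(e).\<close>
lemma place_poly_unit:
  assumes F: "is_subfield F" and v: "place F v" and e: "e \<in> F" and pos: "v (w - e) > 0"
    and p: "p \<in> polys F" "poly p e \<noteq> 0"
  shows "poly p w \<noteq> 0" "v (poly p w) = 0"
proof -
  note A = subfield_subring[OF F]
  have pe: "poly p e \<in> F" using A p e by (intro poly_in_subring)
  note q = polys_synthetic_div[OF A e]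
  have w: "v w \<ge> 0"
    using place_add_nonneg[OF v, of "w - e" e] pos place_const[OF v e] by simp
  let ?b = "(w - e) * poly (synthetic_div p e) w"
  have "p + smult e (synthetic_div p e) = pCons (poly p e) (synthetic_div p e)"
    by (rule synthetic_div_correct)
  from arg_cong[OF this, of "\<lambda>p. poly p w"] have eq: "poly p w = poly p e + ?b"
    by (simp add: algebra_simps)
  have "w - e \<noteq> 0" using pos v by auto
  then have "?b = 0 \<or> v (poly p e) < v ?b"
    using place_poly_nonneg[OF v q[OF p(1)] w] pos place_const[OF v pe] place_mult[OF v, of "w - e"]
    by fastforce
  from place_add_eq[OF v p(2) this] show "poly p w \<noteq> 0" "v (poly p w) = 0"
    using eq place_const[OF v pe] by auto
qed

text \<open>\<open>j\<close> is the multiplicity of e as a root of p: X - e is divided out until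
  \<open>place_poly_unit\<close> applies. It is chosen before v, because places above w = e will be
  compared with each other.\<close>

lemma place_ratfun_poly:
  assumes F: "is_subfield F" and e: "e \<in> F" and "p \<in> polys F" "p \<noteq> 0"
  shows "\<exists>j. \<forall>v. place F v \<and> v (w - e) > 0 \<longrightarrow> poly p w \<noteq> 0 \<and> v (poly p w) = int j * v (w - e)"
  using assms(3,4)
proof (induction "degree p" arbitrary: p rule: less_induct)
  case less
  note A = subfield_subring[OF F]
  show ?case
  proof (cases "poly p e = 0")
    case False
    then show ?thesis using place_poly_unit[OF F _ e _ less(2)] by (intro exI[of _ 0]) auto
  next
    case True
    let ?s = "synthetic_div p e"
    have p: "p = [:-e, 1:] * ?s"
      using synthetic_div_correct'[of e p] True by simp
    have s: "?s \<noteq> 0" "?s \<in> polys F"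
      using p less(3) polys_synthetic_div[OF A e less(2)] by auto
    have "degree p = degree [:-e, 1:] + degree ?s"
      using s degree_mult_eq[of "[:-e, 1:]" ?s] arg_cong[OF p, of degree] by simp
    then have "degree ?s < degree p" by simp
    from less(1)[OF this s(2,1)] obtain j where
      j: "\<forall>v. place F v \<and> v (w - e) > 0 \<longrightarrow> poly ?s w \<noteq> 0 \<and> v (poly ?s w) = int j * v (w - e)"
      by blast
    have pw: "poly p w = (w - e) * poly ?s w" using arg_cong[OF p, of "\<lambda>p. poly p w"]
      by (simp add: algebra_simps)
    show ?thesis
    proof (intro exI[of _ "Suc j"] allI impI)
      fix v assume v: "place F v \<and> v (w - e) > 0"
      then have "w - e \<noteq> 0" by auto
      then show "poly p w \<noteq> 0 \<and> v (poly p w) = int (Suc j) * v (w - e)"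
        unfolding pw using v j place_mult[of F v "w - e" "poly ?s w"] by (auto simp: distrib_right)
    qed
  qed
qed

lemma place_ratfun:
  assumes F: "is_subfield F" and e: "e \<in> F" and a: "a \<in> ratfuns F w" "a \<noteq> 0"
  shows "\<exists>j. \<forall>v. place F v \<and> v (w - e) > 0 \<longrightarrow> v a = j * v (w - e)"
proof -
  obtain p r where pr: "a = poly p w / poly r w" "p \<in> polys F" "r \<in> polys F"
    using a by (auto simp: ratfuns_def)
  then have nz: "p \<noteq> 0" "r \<noteq> 0" using a by auto
  obtain i where i: "\<forall>v. place F v \<and> v (w - e) > 0 \<longrightarrow> poly p w \<noteq> 0 \<and> v (poly p w) = int i * v (w - e)"
    using place_ratfun_poly[OF F e pr(2) nz(1)] by blast
  obtain j where j: "\<forall>v. place F v \<and> v (w - e) > 0 \<longrightarrow> poly r w \<noteq> 0 \<and> v (poly r w) = int j * v (w - e)"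
    using place_ratfun_poly[OF F e pr(3) nz(2)] by blast
  show ?thesis
    by (rule exI[of _ "int i - int j"])
      (use i j pr in \<open>auto simp: place_divide algebra_simps\<close>)
qed

text \<open>F(w) = F(1/w), and 1/w vanishes at v, so this is the case e = 0 of
  \<open>place_ratfun\<close>.\<close>

lemma place_ratfun_pole:
  assumes F: "is_subfield F" and a: "a \<in> ratfuns F w" "a \<noteq> 0" and v: "place F v" "v w < 0"
  shows "\<exists>j. v a = j * v w"
proof -
  note A = subfield_subring[OF F]
  have "inverse w \<in> ratfuns F (inverse w)" using ratfuns_gen[OF F] .
  then have "w \<in> ratfuns F (inverse w)"
    using subfield_ratfuns[OF F, of "inverse w"] by (metis inverse_inverse_eq is_subfield_def)
  then have "ratfuns F w \<subseteq> ratfuns F (inverse w)"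
    using subfield_ratfuns[OF F] ratfuns_const[OF F] by (intro ratfuns_subset) auto
  then have "a \<in> ratfuns F (inverse w)" using a by auto
  from place_ratfun[OF F subring_0[OF A] this a(2)] obtain j where
    "v a = j * v (inverse w)" using v by (auto simp: place_inverse)
  then have "v a = (- j) * v w" using v(1) by (simp add: place_inverse)
  then show ?thesis by blast
qed

section \<open>Valuation rings and the existence of poles\<close>

definition valuation_ring :: "'k::field set \<Rightarrow> bool" where
  "valuation_ring A \<longleftrightarrow> subring_of A \<and> (\<forall>s. s \<noteq> 0 \<longrightarrow> s \<in> A \<or> inverse s \<in> A)"

definition ring_units :: "'k::field set \<Rightarrow> 'k set" where
  "ring_units A = {u. u \<noteq> 0 \<and> u \<in> A \<and> inverse u \<in> A}"

lemma valuation_ringD: "valuation_ring A \<Longrightarrow> s \<noteq> 0 \<Longrightarrow> s \<in> A \<or> inverse s \<in> A"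
  by (simp add: valuation_ring_def)

lemma ex_maximal_subring:
  assumes A0: "subring_of A0" "z \<notin> A0"
  shows "\<exists>A. subring_of A \<and> A0 \<subseteq> A \<and> z \<notin> A \<and>
    (\<forall>B. subring_of B \<longrightarrow> A \<subseteq> B \<longrightarrow> z \<notin> B \<longrightarrow> B = A)"
proof -
  define \<A> where "\<A> = {A. subring_of A \<and> A0 \<subseteq> A \<and> z \<notin> A}"
  have "\<exists>M\<in>\<A>. \<forall>X\<in>\<A>. M \<subseteq> X \<longrightarrow> X = M"
  proof (rule subset_Zorn_nonempty)
    show "\<A> \<noteq> {}" using A0 by (auto simp: \<A>_def)
    fix C assume C: "C \<noteq> {}" "subset.chain \<A> C"
    have mem: "subring_of A \<and> A0 \<subseteq> A \<and> z \<notin> A" if "A \<in> C" for A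
      using that C by (auto simp: subset_chain_def \<A>_def)
    have two: "\<exists>A\<in>C. a \<in> A \<and> b \<in> A" if ab: "a \<in> \<Union>C" "b \<in> \<Union>C" for a b
    proof -
      obtain A B where AB: "A \<in> C" "B \<in> C" "a \<in> A" "b \<in> B" using ab by auto
      then have "A \<subseteq> B \<or> B \<subseteq> A" using C by (auto simp: subset_chain_def)
      then show ?thesis using AB by blast
    qed
    have "subring_of (\<Union>C)"
      unfolding subring_of_def
    proof (intro conjI ballI)
      show "0 \<in> \<Union>C" "1 \<in> \<Union>C" using C(1) mem by (auto intro: subringD)
      show "a + b \<in> \<Union>C" "a * b \<in> \<Union>C" if "a \<in> \<Union>C" "b \<in> \<Union>C" for a b
        using two[OF that] mem by (auto intro: subringD)
      show "- a \<in> \<Union>C" if "a \<in> \<Union>C" for a using that mem by (auto intro: subringD)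
    qed
    then show "\<Union>C \<in> \<A>" using C(1) mem by (auto simp: \<A>_def)
  qed
  then obtain M where "M \<in> \<A>" and "\<forall>X\<in>\<A>. M \<subseteq> X \<longrightarrow> X = M" by blast
  then show ?thesis by (intro exI[of _ M]) (auto simp: \<A>_def)
qed

text \<open>Multiplying z = r(1/s) by t s^k, with k the degree of p, gives (1 - r_0 t) s^k = t R(s)
  with deg R < k. As 1 - r_0 t is a unit, s^k becomes a polynomial of lower degree in s, which
  replaces the leading power in p.\<close>

lemma maximal_subring_descent:
  assumes A: "subring_of A" and t: "t \<in> A" and s: "s \<noteq> 0" and z: "z \<noteq> 0" "t = inverse z"
    and unit: "\<And>a. a \<in> A \<Longrightarrow> 1 - a * t \<noteq> 0 \<and> inverse (1 - a * t) \<in> A"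
    and p: "p \<in> polys A" "z = poly p s" and r: "r \<in> polys A" "z = poly r (inverse s)"
    and deg: "degree r \<le> degree p" "degree p > 0"
  shows "\<exists>p'\<in>polys A. z = poly p' s \<and> degree p' < degree p"
proof -
  let ?k = "degree p"
  define u where "u = 1 - coeff r 0 * t"
  \<comment> \<open>s^k r(1/s) without its top term \<open>coeff r 0 * s ^ k\<close>; summing up to
    the degree of p only adds zero coefficients.\<close>
  define R where "R = (\<Sum>i=1..?k. monom (coeff r i) (?k - i))"
  have u: "u \<noteq> 0" "inverse u \<in> A" using unit polys_coeff[OF r(1)] by (auto simp: u_def)
  have R: "R \<in> polys A" "degree R < ?k"
  proof -
    show "R \<in> polys A" unfolding R_def
      using A r by (intro polys_sum polysI polys_coeff)
    have "degree R \<le> ?k - 1" unfolding R_def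
      by (rule degree_sum_le) (auto intro!: order.trans[OF degree_monom_le])
    then show "degree R < ?k" using deg by simp
  qed
  have "poly r (inverse s) = (\<Sum>i\<le>?k. coeff r i * inverse s ^ i)"
    unfolding poly_altdef using deg(1)
    by (intro sum.mono_neutral_left) (auto simp: coeff_eq_0)
  also have "\<dots> * s ^ ?k = (\<Sum>i\<le>?k. coeff r i * s ^ (?k - i))"
    unfolding sum_distrib_right
    by (intro sum.cong) (use s in \<open>auto simp: power_diff power_inverse field_simps\<close>)
  also have "\<dots> = coeff r 0 * s ^ ?k + poly R s"
    by (simp add: R_def poly_sum poly_monom sum.atLeast_Suc_atMost atMost_atLeast0)
  finally have "z * s ^ ?k = coeff r 0 * s ^ ?k + poly R s" using r by simp
  then have "t * (z * s ^ ?k) = t * (coeff r 0 * s ^ ?k + poly R s)" by simp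
  moreover have "t * (z * s ^ ?k) = s ^ ?k" using z by simp
  ultimately have "s ^ ?k = t * (coeff r 0 * s ^ ?k + poly R s)" by simp
  then have "u * s ^ ?k = t * poly R s" by (simp add: u_def algebra_simps)
  then have sk: "s ^ ?k = poly (smult (inverse u * t) R) s"
    using u by (simp add: field_simps)
  define p' where "p' = (p - monom (lead_coeff p) ?k) + smult (lead_coeff p) (smult (inverse u * t) R)"
  have "p' \<in> polys A" unfolding p'_def
    using A p R u t by (intro polysI subring_mult polys_coeff)
  moreover have "poly p' s = z"
    unfolding p'_def poly_add poly_diff poly_smult[of "lead_coeff p"] sk[symmetric]
    using p by (simp add: poly_monom)
  moreover have "degree p' < ?k"
  proof -
    have "coeff (p - monom (lead_coeff p) ?k) i = 0" if "i \<ge> ?k" for i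
      using that by (auto simp: coeff_monom coeff_eq_0 le_less)
    then have "degree (p - monom (lead_coeff p) ?k) < ?k"
      using deg(2) by (intro degree_lessI) blast+
    moreover have "degree (smult (lead_coeff p) (smult (inverse u * t) R)) < ?k"
      using R(2) degree_smult_le le_less_trans by meson
    ultimately show ?thesis unfolding p'_def by (rule degree_add_less)
  qed
  ultimately show ?thesis by auto
qed

text \<open>By maximality z lies in A[s] for every s outside A. If s and 1/s were both outside, z
  would have expressions of least degree in each, and the descent would shorten the longer
  one.\<close>

lemma maximal_subring_valuation_ring:
  assumes A: "subring_of A" and z: "z \<noteq> 0" "inverse z \<in> A" "z \<notin> A"
    and max: "\<And>B. subring_of B \<Longrightarrow> A \<subseteq> B \<Longrightarrow> z \<notin> B \<Longrightarrow> B = A"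
  shows "valuation_ring A"
proof -
  define t where "t = inverse z"
  have tA: "t \<in> A" and zt: "z * t = 1" using z by (auto simp: t_def)
  have adj: "\<exists>p\<in>polys A. z = poly p s" if "s \<notin> A" for s
  proof -
    have "adjoin A s \<noteq> A" using that adjoin_mem[OF A] by blast
    then have "z \<in> adjoin A s"
      using max[OF subring_adjoin[OF A] adjoin_subset[OF A]] by blast
    then show ?thesis by (auto simp: adjoin_def)
  qed
  \<comment> \<open>If d = 1 - a t had no inverse in A, then z would be a polynomial in 1/d, so z
    d^k would lie in A for its degree k. But z t = 1 makes z d^k equal to z plus an element of
    A.\<close>
  have unit: "1 - a * t \<noteq> 0 \<and> inverse (1 - a * t) \<in> A" if a: "a \<in> A" for a
  proof -
    have cong: "\<exists>b\<in>A. z * (1 - a * t) ^ k = z + b" for k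
    proof (induction k)
      case (Suc k)
      then obtain b where b: "b \<in> A" "z * (1 - a * t) ^ k = z + b" by auto
      have "z * (1 - a * t) ^ Suc k = (z + b) * (1 - a * t)"
        using b(2) by (simp add: mult.assoc mult.commute)
      also have "\<dots> = z + (b - a * (z * t) - b * (a * t))" by (simp add: algebra_simps)
      finally show ?case using zt a b tA A
        by (intro bexI[of _ "b - a * (z * t) - b * (a * t)"]) (auto intro!: subring_diff subring_mult)
    qed (use A in \<open>auto intro!: bexI[of _ 0] subring_0\<close>)
    have nz: "1 - a * t \<noteq> 0" 
    proof
      assume "1 - a * t = 0"
      then have "a * t * z = z" by simp
      then have "a = z" using zt by (simp add: mult.assoc mult.commute[of t])
      then show False using a z by simp
    qed
    have "inverse (1 - a * t) \<in> A"
    proof (rule ccontr)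
      let ?d = "1 - a * t"
      assume "inverse ?d \<notin> A"
      from adj[OF this] obtain p where p: "p \<in> polys A" "z = poly p (inverse ?d)" by auto
      have dA: "?d \<in> A" using A a tA by (intro subring_diff subring_mult subring_1)
      have "z * ?d ^ degree p = poly (reflect_poly p) ?d"
        using p nz by (subst poly_reflect_poly_nz) (auto simp: mult.commute)
      also have "\<dots> \<in> A"
        using A dA p by (intro poly_in_subring) (auto simp: polys_def coeff_reflect_poly subring_0)
      finally have zd: "z * ?d ^ degree p \<in> A" .
      obtain b where "b \<in> A" "z * ?d ^ degree p = z + b" using cong by blast
      then show False using zd z subring_diff[OF A zd, of b] by simp
    qed
    with nz show ?thesis by simp
  qed
  have False if s: "s \<noteq> 0" "s \<notin> A" "inverse s \<notin> A" for s
  proof -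
    define D where "D s d \<longleftrightarrow> (\<exists>p\<in>polys A. z = poly p s \<and> degree p = d)" for s d
    have min: "\<exists>d>0. D s d \<and> (\<forall>d'<d. \<not> D s d')" if "s \<notin> A" for s
    proof -
      have ex: "\<exists>d. D s d" using adj[OF that] by (auto simp: D_def)
      have "\<not> D s 0"
      proof
        assume "D s 0"
        then obtain p where "p \<in> polys A" "z = poly p s" "degree p = 0" by (auto simp: D_def)
        then have "z = coeff p 0" by (auto elim!: degree_eq_zeroE)
        then show False using z polys_coeff[OF \<open>p \<in> polys A\<close>] by simp
      qed
      moreover obtain d where "D s d" "\<forall>d'<d. \<not> D s d'"
        using ex exists_least_iff[of "D s"] by blast
      ultimately show ?thesis by (intro exI[of _ d]) (cases d; simp)
    qed
    have desc: "\<exists>d''<d. D s d''" if sd: "s \<noteq> 0" "D s d" "D (inverse s) d'" "d' \<le> d" "d > 0" for s d d'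
    proof -
      obtain p r where "p \<in> polys A" "z = poly p s" "degree p = d"
        "r \<in> polys A" "z = poly r (inverse s)" "degree r = d'"
        using sd(2,3) unfolding D_def by blast
      then show ?thesis
        using maximal_subring_descent[OF A tA sd(1) z(1) t_def unit, of p r] sd(4,5)
        unfolding D_def by blast
    qed
    obtain d where d: "d > 0" "D s d" "\<forall>d'<d. \<not> D s d'" using min[OF s(2)] by auto
    obtain e where e: "e > 0" "D (inverse s) e" "\<forall>d'<e. \<not> D (inverse s) d'" using min[OF s(3)] by auto
    show False
    proof (cases "e \<le> d")
      case True
      then show False using desc[OF s(1) d(2) e(2) _ d(1)] d(3) by blast
    next
      case False
      then show False using desc[of "inverse s" e d] d e s by auto
    qed
  qed
  then show ?thesis using A by (auto simp: valuation_ring_def)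
qed

section \<open>From a valuation ring to a discrete place\<close>

lemma ring_units_mult: "subring_of A \<Longrightarrow> u \<in> ring_units A \<Longrightarrow> u' \<in> ring_units A \<Longrightarrow> u * u' \<in> ring_units A"
  by (auto simp: ring_units_def subring_mult)

lemma ring_units_inverse: "u \<in> ring_units A \<Longrightarrow> inverse u \<in> ring_units A"
  by (auto simp: ring_units_def)

lemma ring_units_1: "subring_of A \<Longrightarrow> 1 \<in> ring_units A"
  by (auto simp: ring_units_def subring_1)

lemma ring_units_power: "subring_of A \<Longrightarrow> u \<in> ring_units A \<Longrightarrow> u ^ k \<in> ring_units A"
  by (induction k) (auto intro: ring_units_mult ring_units_1)

lemma ring_units_powerD:
  assumes A: "valuation_ring A" and "N > 0" "u \<noteq> 0" "u ^ N \<in> ring_units A"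
  shows "u \<in> A"
proof (rule ccontr)
  assume "u \<notin> A"
  then have "inverse u \<in> A" using A assms by (auto simp: valuation_ring_def)
  then have "u ^ N * inverse u ^ (N - 1) \<in> A"
    using A assms by (auto simp: valuation_ring_def ring_units_def intro!: subring_mult subring_power)
  moreover obtain N' where "N = Suc N'" using assms by (cases N) auto
  then have "u ^ N * inverse u ^ (N - 1) = u"
    using assms by (simp add: power_inverse)
  ultimately show False using \<open>u \<notin> A\<close> by simp
qed

text \<open>The image of v is a nonzero subgroup of the integers, and g is its least positive
  element. Dividing by g gives the surjectivity that \<open>place\<close> demands.\<close>

lemma hom_int_normalize:
  fixes v :: "'k::field \<Rightarrow> int"
  assumes hom: "\<And>a b. a \<noteq> 0 \<Longrightarrow> b \<noteq> 0 \<Longrightarrow> v (a * b) = v a + v b"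
    and d: "d \<noteq> 0" "v d > 0"
  shows "\<exists>g>0. (\<forall>a. a \<noteq> 0 \<longrightarrow> g dvd v a) \<and> (\<exists>b. b \<noteq> 0 \<and> v b = g)"
proof -
  define P where "P k \<longleftrightarrow> k > 0 \<and> (\<exists>b. b \<noteq> 0 \<and> v b = int k)" for k
  have "P (nat (v d))" using d by (auto simp: P_def)
  then obtain k where k: "P k" "\<forall>j<k. \<not> P j" using exists_least_iff[of P] by blast
  then obtain b where b: "b \<noteq> 0" "v b = int k" "k > 0" by (auto simp: P_def)
  have v1: "v 1 = 0" using hom[of 1 1] by simp
  have inv: "v (inverse a) = - v a" if "a \<noteq> 0" for a
    using hom[of a "inverse a"] v1 that by simp
  have pow: "v (a ^ j) = int j * v a" if "a \<noteq> 0" for a j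
    using that v1 by (induction j) (auto simp: hom algebra_simps)
  have powi: "v (a powi j) = j * v a" if "a \<noteq> 0" for a j
    using that by (auto simp: power_int_def pow inv)
  have "int k dvd v a" if a: "a \<noteq> 0" for a
  proof -
    \<comment> \<open>This element has value \<open>v a mod int k\<close>, which by minimality of k
      cannot be positive.\<close>
    let ?a = "a * b powi (- (v a div int k))"
    have "v ?a = v a - v a div int k * int k"
      using a b by (simp add: hom powi del: power_int_minus power_int_minus_left)
    then have va: "v ?a = v a mod int k" by (simp add: minus_div_mult_eq_mod)
    have "?a \<noteq> 0" using a b by simp
    then have "v a mod int k > 0 \<Longrightarrow> P (nat (v a mod int k))"
      using va unfolding P_def by (intro conjI exI[of _ ?a]) auto
    moreover have "nat (v a mod int k) < k" using b by (simp add: nat_less_iff)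
    ultimately have "\<not> v a mod int k > 0" using k(2) by blast
    moreover have "v a mod int k \<ge> 0" using b by simp
    ultimately have "v a mod int k = 0" by linarith
    then show ?thesis by presburger
  qed
  then show ?thesis using b by (intro exI[of _ "int k"]) auto
qed

text \<open>Up to units, a^N is a power d^k. The exponent k is additive in a and is nonnegative
  exactly on A, so it is a valuation up to the scaling that makes it surjective.\<close>

lemma place_of_valuation_ring:
  fixes A F :: "'k::field set"
  assumes A: "valuation_ring A" and F: "is_subfield F" "F \<subseteq> A"
    and d: "d \<in> A" "d \<noteq> 0" "inverse d \<notin> A" and N: "N > 0"
    and ex: "\<And>a. a \<noteq> 0 \<Longrightarrow> \<exists>k. a ^ N / d powi k \<in> ring_units A"
  shows "\<exists>Q. place F Q \<and> (\<forall>a. a \<noteq> 0 \<longrightarrow> (Q a \<ge> 0 \<longleftrightarrow> a \<in> A))"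
proof -
  have R: "subring_of A" using A by (simp add: valuation_ring_def)
  let ?U = "ring_units A"
  \<comment> \<open>A positive power of d dividing a unit would make d itself a unit.\<close>
  have pos: "j = 0" if j: "a * d ^ j \<in> ?U" "a \<in> A" for a j
  proof (rule ccontr)
    assume "j \<noteq> 0"
    then obtain i where i: "j = Suc i" by (cases j) auto
    let ?u = "a * d ^ j"
    have "a * d ^ i * inverse ?u \<in> A"
      using j d R by (intro subring_mult subring_power) (auto simp: ring_units_def)
    moreover have "a * d ^ i * inverse ?u = inverse d"
      using j d i by (auto simp: ring_units_def field_simps)
    ultimately show False using d by simp
  qed
  have dk0: "k = 0" if "d powi k \<in> ?U" for k
    using that pos[of 1 "nat k"] pos[of 1 "nat (-k)"] ring_units_inverse[OF that] subring_1[OF R]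
    by (cases "k \<ge> 0") (auto simp: power_int_def power_inverse)
  have uniq: "k = l" if "a \<noteq> 0" "a ^ N / d powi k \<in> ?U" "a ^ N / d powi l \<in> ?U" for a k l
  proof -
    have "(a ^ N / d powi k) * inverse (a ^ N / d powi l) \<in> ?U"
      using that R by (intro ring_units_mult ring_units_inverse)
    also have "(a ^ N / d powi k) * inverse (a ^ N / d powi l) = d powi (l - k)"
      using that d by (simp add: power_int_diff field_simps)
    finally show ?thesis using dk0 by force
  qed
  define v where "v a = (THE k. a ^ N / d powi k \<in> ?U)" for a
  have v: "a ^ N / d powi v a \<in> ?U" if "a \<noteq> 0" for a
    unfolding v_def by (rule theI') (use ex[OF that] uniq[OF that] in blast)
  have v_eq: "v a = k" if "a \<noteq> 0" "a ^ N / d powi k \<in> ?U" for a k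
    using uniq[OF that(1) v[OF that(1)] that(2)] .
  have hom: "v (a * b) = v a + v b" if "a \<noteq> 0" "b \<noteq> 0" for a b
  proof (rule v_eq)
    have "(a * b) ^ N / d powi (v a + v b) = (a ^ N / d powi v a) * (b ^ N / d powi v b)"
      using d by (simp add: power_int_add power_mult_distrib)
    then show "(a * b) ^ N / d powi (v a + v b) \<in> ?U"
      using ring_units_mult[OF R v[OF that(1)] v[OF that(2)]] by simp
  qed (use that in auto)
  have v_nonneg: "v a \<ge> 0" if a: "a \<in> A" "a \<noteq> 0" for a
  proof (rule ccontr)
    assume neg: "\<not> v a \<ge> 0"
    have "a ^ N * d ^ nat (- v a) \<in> ?U"
      using v[OF a(2)] neg by (simp add: power_int_def power_inverse divide_inverse)
    from pos[OF this subring_power[OF R a(1)]] show False using neg by simp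
  qed
  have v1: "v 1 = 0" using hom[of 1 1] by simp
  have v_iff: "v a \<ge> 0 \<longleftrightarrow> a \<in> A" if a: "a \<noteq> 0" for a
  proof
    assume "v a \<ge> 0"
    show "a \<in> A"
    proof (rule ccontr)
      assume na: "a \<notin> A"
      then have "inverse a \<in> A" using A a by (auto simp: valuation_ring_def)
      then have "v (inverse a) \<ge> 0" using v_nonneg a by simp
      moreover have "v (inverse a) = - v a" using hom[of a "inverse a"] a v1 by simp
      ultimately have "v a = 0" using \<open>v a \<ge> 0\<close> by simp
      then have "a ^ N \<in> ?U" using v[OF a] by simp
      then show False using ring_units_powerD[OF A N a] na by simp
    qed
  qed (use v_nonneg a in auto)
  \<comment> \<open>A positive value, so that \<open>hom_int_normalize\<close> applies.\<close>
  have "v d = int N"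
    by (rule v_eq) (use d R ring_units_1 in auto)
  then obtain g b where g: "g > 0" "\<And>a. a \<noteq> 0 \<Longrightarrow> g dvd v a" and b: "b \<noteq> 0" "v b = g"
    using hom_int_normalize[of v d, OF hom] d N by auto
  define Q where "Q a = (if a = 0 then 0 else v a div g)" for a
  have Qhom: "Q (a * b) = Q a + Q b" if "a \<noteq> 0" "b \<noteq> 0" for a b
    using that g hom by (simp add: Q_def div_plus_div_distrib_dvd_left)
  have Q_iff: "Q a \<ge> 0 \<longleftrightarrow> a \<in> A" if "a \<noteq> 0" for a
    using that g v_iff by (simp add: Q_def pos_imp_zdiv_nonneg_iff)
  have Q1: "Q 1 = 0" using Qhom[of 1 1] by simp
  have inv: "Q (inverse a) = - Q a" if "a \<noteq> 0" for a
    using Qhom[of a "inverse a"] Q1 that by simp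
  have Qadd1: "min (Q a) (Q b) \<le> Q (a + b)" if ab: "a \<noteq> 0" "b \<noteq> 0" "a + b \<noteq> 0" "Q a \<le> Q b" for a b
  proof -
    have "Q (b * inverse a) \<ge> 0" using ab inv by (subst Qhom) auto
    then have "b * inverse a \<in> A" using Q_iff ab by simp
    then have "1 + b * inverse a \<in> A" using R by (intro subring_add subring_1)
    moreover have nz: "1 + b * inverse a \<noteq> 0" using ab by (auto simp: field_simps add_eq_0_iff)
    ultimately have "Q (1 + b * inverse a) \<ge> 0" using Q_iff by simp
    moreover have "a + b = a * (1 + b * inverse a)" using ab by (simp add: field_simps)
    ultimately show ?thesis using Qhom[OF ab(1) nz] by auto
  qed
  have "place F Q"
    unfolding place_def
  proof (intro conjI allI impI ballI)
    show "Q 0 = 0" by (simp add: Q_def)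
    have pow: "Q (a ^ j) = int j * Q a" if "a \<noteq> 0" for a j
      using that Q1 by (induction j) (auto simp: Qhom algebra_simps)
    have "Q b = 1" using b g by (simp add: Q_def)
    then have "Q (b powi k) = k" for k
      using b by (auto simp: power_int_def pow inv)
    then show "surj Q" by (metis surjI)
    show "min (Q a) (Q b) \<le> Q (a + b)" if "a \<noteq> 0" "b \<noteq> 0" "a + b \<noteq> 0" for a b
      using Qadd1[of a b] Qadd1[of b a] that by (cases "Q a \<le> Q b") (auto simp: add.commute)
    show "Q c = 0" if "c \<in> F" "c \<noteq> 0" for c
    proof -
      have "inverse c \<in> F" using F that by (simp add: is_subfield_def)
      then have "c \<in> A" "inverse c \<in> A" using that F by auto
      then show ?thesis using Q_iff[of c] Q_iff[of "inverse c"] inv[of c] that by auto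
    qed
  qed (rule Qhom)
  then show ?thesis using Q_iff by blast
qed

text \<open>In a vanishing sum two terms have equal value. Before a valuation exists, equal value
  has to be expressed by a unit quotient.\<close>

lemma valuation_ring_sum_unit_ratio:
  assumes A: "valuation_ring A" and I: "finite I" "I \<noteq> {}"
    and t: "\<And>i. i \<in> I \<Longrightarrow> t i \<noteq> 0" "(\<Sum>i\<in>I. t i) = 0"
  shows "\<exists>i\<in>I. \<exists>j\<in>I. i \<noteq> j \<and> t i / t j \<in> ring_units A"
proof (rule ccontr)
  assume no: "\<not> ?thesis"
  have R: "subring_of A" using A by (simp add: valuation_ring_def)
  \<comment> \<open>Without such a pair every partial sum is a unit times one of its terms, hence
    nonzero; this is the form that survives the induction.\<close>
  have "sum t I \<noteq> 0 \<and> (\<exists>i\<in>I. sum t I / t i \<in> ring_units A)"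
    using I no t(1)
  proof (induction I rule: finite_ne_induct)
    case (singleton i)
    then show ?case using ring_units_1[OF R] by auto
  next
    case (insert i I)
    then obtain j where j: "j \<in> I" "sum t I / t j \<in> ring_units A" "sum t I \<noteq> 0" by auto
    define s where "s = sum t I"
    have nu: "t i / s \<notin> ring_units A"
    proof
      assume "t i / s \<in> ring_units A"
      then have "t i / s * (s / t j) \<in> ring_units A"
        using j(2) unfolding s_def by (rule ring_units_mult[OF R])
      then have "t i / t j \<in> ring_units A" using j by (simp add: s_def)
      moreover have "i \<noteq> j" using insert.hyps j by auto
      ultimately show False using insert.prems(1) j(1) by (meson insertI1 insertI2)
    qed
    \<comment> \<open>Apply the valuation ring property to (1 + a)/a: one alternative puts 1/a into
      A, the other puts 1/(1 + a) there.\<close>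
    have key: "1 + a \<in> ring_units A" if "a \<in> A" "a \<noteq> 0" "inverse a \<notin> A" for a
    proof -
      have nz: "1 + a \<noteq> 0"
      proof
        assume "1 + a = 0"
        then have "a = - 1" using minus_unique[of 1 a] by simp
        then show False using that by simp
      qed
      have "inverse (1 + a) \<in> A"
      proof (rule ccontr)
        assume na: "inverse (1 + a) \<notin> A"
        have "(1 + a) / a \<in> A \<or> inverse ((1 + a) / a) \<in> A"
          by (rule valuation_ringD[OF A]) (use nz that(2) in simp)
        moreover have eq: "(1 + a) / a - 1 = inverse a" "1 - inverse ((1 + a) / a) = inverse (1 + a)"
          using nz that(2) by (simp_all add: divide_simps)
        ultimately show False
        proof (elim disjE)
          assume "(1 + a) / a \<in> A"
          from subring_diff[OF R this subring_1[OF R]] show False using that(3) unfolding eq by blast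
        next
          assume "inverse ((1 + a) / a) \<in> A"
          from subring_diff[OF R subring_1[OF R] this] show False using na unfolding eq by blast
        qed
      qed
      then show ?thesis using nz that R by (auto simp: ring_units_def intro: subring_add subring_1)
    qed
    have ti: "t i \<noteq> 0" using insert by simp
    have sn: "s \<noteq> 0" using j by (simp add: s_def)
    have sum: "sum t (insert i I) = t i + s" using insert by (simp add: s_def)
    show ?case
    proof (cases "t i / s \<in> A")
      case True
      then have "1 + t i / s \<in> ring_units A" using nu ti sn by (intro key) (auto simp: ring_units_def)
      then have nz: "1 + t i / s \<noteq> 0" and "(1 + t i / s) * (s / t j) \<in> ring_units A"
        using ring_units_mult[OF R _ j(2)] by (auto simp: s_def ring_units_def[of A])
      moreover have eq: "(1 + t i / s) * s = t i + s" using sn by (simp add: distrib_right)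
      moreover from eq nz sn have "t i + s \<noteq> 0" by (metis mult_eq_0_iff)
      ultimately show ?thesis using j(1) sum by (auto simp: times_divide_eq_right)
    next
      case False
      then have "s / t i \<in> A" using valuation_ringD[OF A, of "t i / s"] ti sn by simp
      then have "1 + s / t i \<in> ring_units A" using False ti sn by (intro key) auto
      moreover have "1 + s / t i = sum t (insert i I) / t i"
        using ti unfolding sum by (simp add: add_divide_distrib)
      ultimately have "sum t (insert i I) / t i \<in> ring_units A" by simp
      moreover from this have "sum t (insert i I) \<noteq> 0" unfolding ring_units_def by force
      ultimately show ?thesis by blast
    qed
  qed
  then show False using t(2) by simp
qed

text \<open>A is local: if a + b is a unit and b/a lies in A, then 1/a = (1 + b/a)/(a + b) lies in
  A. One of a/b and b/a always does.\<close>

lemma valuation_ring_nonunit_add: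
  assumes A: "valuation_ring A" and a: "a \<in> A" "a \<notin> ring_units A" and b: "b \<in> A" "b \<notin> ring_units A"
  shows "a + b \<notin> ring_units A"
proof -
  have R: "subring_of A" using A by (simp add: valuation_ring_def)
  have *: False if a: "a \<noteq> 0" "a \<in> A" "a \<notin> ring_units A" and b: "b / a \<in> A" and u: "a + b \<in> ring_units A"
    for a b
  proof -
    have "(1 + b / a) * inverse (a + b) \<in> A"
      using u b R by (intro subring_mult subring_add subring_1) (auto simp: ring_units_def)
    moreover have "(1 + b / a) * inverse (a + b) = inverse a"
      using a u by (auto simp: ring_units_def divide_simps)
    ultimately show False using a by (simp add: ring_units_def)
  qed
  show ?thesis
  proof (cases "a = 0 \<or> b = 0")
    case False
    then have "a / b \<in> A \<or> inverse (a / b) \<in> A" by (intro valuation_ringD[OF A]) auto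
    then show ?thesis using *[of b a] *[of a b] a b False by (auto simp: add.commute)
  qed (use a b in auto)
qed

text \<open>Long division by leading terms; the point is that quotient and remainder keep their
  coefficients in F.\<close>

lemma polys_division:
  assumes F: "is_subfield F" and d: "d \<in> polys F" "d \<noteq> 0" and "r \<in> polys F"
  shows "\<exists>s\<in>polys F. \<exists>t\<in>polys F. r = d * s + t \<and> (t = 0 \<or> degree t < degree d)"
  using assms(4)
proof (induction "degree r" arbitrary: r rule: less_induct)
  case less
  note R = subfield_subring[OF F]
  show ?case
  proof (cases "r = 0 \<or> degree r < degree d")
    case True
    then show ?thesis using less R by (intro bexI[of _ 0] bexI[of _ r]) (auto intro: polysI)
  next
    case False
    define h where "h = monom (lead_coeff r / lead_coeff d) (degree r - degree d)"
    have h: "h \<in> polys F" unfolding h_def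
      using F R d less by (intro polysI subfield_divide polys_coeff)
    let ?r = "r - d * h"
    have r: "?r \<in> polys F" using R d h less by (intro polysI)
    have h0: "h \<noteq> 0" using False d by (simp add: h_def)
    have dh: "degree (d * h) = degree r"
      using d h0 False by (subst degree_mult_eq) (auto simp: h_def degree_monom_eq)
    have "lead_coeff (d * h) = lead_coeff r"
      unfolding lead_coeff_mult using d False by (simp add: h_def degree_monom_eq)
    then have c: "coeff ?r (degree r) = 0" using dh by simp
    have "?r = 0 \<or> degree ?r < degree r"
    proof -
      have "degree ?r \<le> degree r" using dh by (intro degree_diff_le) auto
      then show ?thesis using c by (metis le_neq_implies_less leading_coeff_0_iff)
    qed
    then show ?thesis
    proof
      assume "?r = 0"
      then show ?thesis using h R by (intro bexI[of _ h] bexI[of _ 0]) (auto intro: polysI)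
    next
      assume "degree ?r < degree r"
      from less(1)[OF this r] obtain s t where st: "s \<in> polys F" "t \<in> polys F"
        "?r = d * s + t" "t = 0 \<or> degree t < degree d" by blast
      then have "r = d * (s + h) + t" by (simp add: algebra_simps)
      then show ?thesis using st h R by (intro bexI[of _ "s + h"] bexI[of _ t]) (auto intro: polysI)
    qed
  qed
qed

text \<open>A nonunit of least degree acts as a prime element of F[w]. If r(w) is a nonunit, so is
  the remainder of r modulo d at w; by minimality it vanishes there, and r(w) = d(w) s(w) with s of
  lower degree.\<close>

lemma valuation_ring_ratfuns_discrete:
  assumes A: "valuation_ring A" and F: "is_subfield F" "F \<subseteq> A" and w: "w \<in> A"
    and d: "d \<in> polys F" "poly d w \<noteq> 0" "poly d w \<notin> ring_units A"
    and min: "\<And>p. p \<in> polys F \<Longrightarrow> degree p < degree d \<Longrightarrow> poly p w \<noteq> 0 \<Longrightarrow> poly p w \<in> ring_units A"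
    and r: "r \<in> polys F" "poly r w \<noteq> 0"
  shows "\<exists>k::nat. poly r w / poly d w ^ k \<in> ring_units A"
  using r
proof (induction "degree r" arbitrary: r rule: less_induct)
  case less
  have R: "subring_of A" using A by (simp add: valuation_ring_def)
  have inA: "poly p w \<in> A" if "p \<in> polys F" for p
    using polys_mono[OF F(2)] that R w by (intro poly_in_subring) auto
  show ?case
  proof (cases "poly r w \<in> ring_units A")
    case True
    then show ?thesis by (intro exI[of _ 0]) simp
  next
    case False
    have "d \<noteq> 0" using d by auto
    from polys_division[OF F(1) d(1) this less(2)] obtain s t where st: "s \<in> polys F" "t \<in> polys F"
      "r = d * s + t" "t = 0 \<or> degree t < degree d" by blast
    have nu: "- (poly d w * poly s w) \<notin> ring_units A"
    proof
      let ?y = "- (poly d w * poly s w)"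
      assume y: "?y \<in> ring_units A"
      then have "- (inverse ?y * poly s w) \<in> A"
        using R inA[OF st(1)] by (intro subring_mult subring_uminus) (auto simp: ring_units_def)
      moreover have "- (inverse ?y * poly s w) = inverse (poly d w)"
        using y d(2) by (cases "poly s w = 0") (simp_all add: ring_units_def)
      ultimately have "inverse (poly d w) \<in> A" by (simp only:)
      then show False using d inA[OF d(1)] by (simp add: ring_units_def)
    qed
    have eq: "poly t w = poly r w + - (poly d w * poly s w)" using st(3) by simp
    have "- (poly d w * poly s w) \<in> A"
      using R inA d(1) st(1) by (intro subring_uminus subring_mult)
    then have "poly t w \<notin> ring_units A"
      unfolding eq by (rule valuation_ring_nonunit_add[OF A inA[OF less(2)] False _ nu])
    then have "poly t w = 0" using min[OF st(2)] st(4) by auto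
    then have rw: "poly r w = poly d w * poly s w" using st(3) by simp
    have d0: "degree d > 0"
    proof (rule ccontr)
      assume "\<not> degree d > 0"
      then obtain a where "d = [:a:]" by (auto elim: degree_eq_zeroE)
      then have "a \<in> F" "a \<noteq> 0" "poly d w = a" using d by (auto dest: polys_pConsD)
      then show False using d F by (auto simp: ring_units_def is_subfield_def)
    qed
    have s0: "s \<noteq> 0" using rw less(3) by auto
    have "degree s < degree r"
    proof -
      have "degree (d * s) = degree d + degree s" using \<open>d \<noteq> 0\<close> s0 by (rule degree_mult_eq)
      moreover have "degree t < degree (d * s)"
        using st(4) calculation d0 by auto
      ultimately show ?thesis using st(3) d0 by (simp add: degree_add_eq_left)
    qed
    from less(1)[OF this st(1)] rw less(3) obtain k where k: "poly s w / poly d w ^ k \<in> ring_units A"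
      by auto
    then show ?thesis using rw d by (intro exI[of _ "Suc k"]) simp
  qed
qed

text \<open>A maximal subring containing F and 1/z but not z is the valuation ring of a pole of z.\<close>
lemma ex_pole:
  fixes z w :: "'k::field"
  assumes F: "is_subfield F"
    and alg: "\<And>a. \<exists>c. (\<forall>j\<le>n. c j \<in> ratfuns F w) \<and> (\<exists>j\<le>n. c j \<noteq> 0) \<and> (\<Sum>j\<le>n. c j * a ^ j) = 0"
    and z: "z \<noteq> 0" "z \<notin> adjoin F (inverse z)"
  shows "\<exists>Q. place F Q \<and> Q z < 0"
proof -
  note RF = subfield_subring[OF F]
  obtain A where R: "subring_of A" and sub: "adjoin F (inverse z) \<subseteq> A" and zA: "z \<notin> A"
    and max: "\<And>B. subring_of B \<Longrightarrow> A \<subseteq> B \<Longrightarrow> z \<notin> B \<Longrightarrow> B = A"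
    using ex_maximal_subring[OF subring_adjoin[OF RF] z(2)] by blast
  have FA: "F \<subseteq> A" and "inverse z \<in> A"
    using sub adjoin_subset[OF RF] adjoin_mem[OF RF] by blast+
  then have A: "valuation_ring A" using maximal_subring_valuation_ring[OF R z(1) _ zA max] by blast
  let ?U = "ring_units A"
  \<comment> \<open>Passing to 1/w if necessary puts F[w'] inside A without losing any element of
    F(w).\<close>
  obtain w' where w': "w' \<in> A" "ratfuns F w \<subseteq> ratfuns F w'"
  proof (cases "w \<in> A")
    case False
    then have "inverse w \<in> A" using valuation_ringD[OF A, of w] subring_0[OF R] by fastforce
    moreover have "w \<in> ratfuns F (inverse w)"
      using subfield_ratfuns[OF F] ratfuns_gen[OF F] by (metis inverse_inverse_eq is_subfield_def)
    then have "ratfuns F w \<subseteq> ratfuns F (inverse w)"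
      using subfield_ratfuns[OF F] ratfuns_const[OF F] by (intro ratfuns_subset) auto
    ultimately show ?thesis using that by blast
  qed (use that in auto)
  \<comment> \<open>Two terms of a relation of degree at most n with unit quotient give a unit
    multiple of a^(i - j) by an element of F(w). The factorial is divisible by every such i - j, so
    N works for all a.\<close>
  define N where "N = (fact n :: nat)"
  have N: "N > 0" by (simp add: N_def)
  have pow: "\<exists>b\<in>ratfuns F w'. b \<noteq> 0 \<and> a ^ N * b \<in> ?U" if a: "a \<noteq> 0" for a
  proof -
    obtain c where c: "\<And>j. j \<le> n \<Longrightarrow> c j \<in> ratfuns F w" "\<exists>j\<le>n. c j \<noteq> 0" "(\<Sum>j\<le>n. c j * a ^ j) = 0"
      using alg by blast
    define I where "I = {j. j \<le> n \<and> c j \<noteq> 0}"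
    have "(\<Sum>j\<in>I. c j * a ^ j) = 0"
      unfolding c(3)[symmetric] by (intro sum.mono_neutral_left) (auto simp: I_def)
    moreover have "finite I" "I \<noteq> {}" using c(2) by (auto simp: I_def)
    ultimately obtain i j where ij: "i \<in> I" "j \<in> I" "i \<noteq> j" "c i * a ^ i / (c j * a ^ j) \<in> ?U"
      using valuation_ring_sum_unit_ratio[OF A, of I "\<lambda>j. c j * a ^ j"] a by (auto simp: I_def)
    have "\<exists>i\<in>I. \<exists>j\<in>I. j < i \<and> c i * a ^ i / (c j * a ^ j) \<in> ?U"
      using ij ring_units_inverse[OF ij(4)] by (cases i j rule: linorder_cases) (auto simp: mult.commute)
    then obtain i j where ij: "i \<in> I" "j \<in> I" "j < i" "c i * a ^ i / (c j * a ^ j) \<in> ?U" by blast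
    have "i - j dvd N" unfolding N_def using ij by (intro dvd_fact) (auto simp: I_def)
    then obtain l where l: "N = (i - j) * l" by (auto simp: dvd_def)
    have "c i * a ^ i / (c j * a ^ j) = a ^ (i - j) * (c i / c j)"
      using ij(3) a by (simp add: power_diff mult.commute)
    then have "a ^ (i - j) * (c i / c j) \<in> ?U" using ij(4) by (simp only:)
    then have "(a ^ (i - j) * (c i / c j)) ^ l \<in> ?U" by (rule ring_units_power[OF R])
    then have "a ^ N * (c i / c j) ^ l \<in> ?U" by (simp only: power_mult_distrib l power_mult)
    moreover have "(c i / c j) ^ l \<in> ratfuns F w'"
    proof -
      have "c i \<in> ratfuns F w'" "c j \<in> ratfuns F w'"
        using w'(2) c(1)[of i] c(1)[of j] ij(1,2) by (auto simp: I_def)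
      then show ?thesis
        by (intro subring_power[OF subfield_subring] subfield_divide subfield_ratfuns[OF F])
    qed
    moreover have "(c i / c j) ^ l \<noteq> 0" using ij(1,2) by (simp add: I_def)
    ultimately show ?thesis by blast
  qed
  \<comment> \<open>A candidate for the prime element. One exists, since otherwise all nonzero
    elements of F(w') would be units, z^N would be a unit too, and z would lie in A.\<close>
  define bad where "bad d \<longleftrightarrow> d \<in> polys F \<and> poly d w' \<noteq> 0 \<and> poly d w' \<notin> ?U" for d
  have "\<exists>d. bad d"
  proof (rule ccontr)
    assume "\<not> ?thesis"
    then have *: "poly p w' \<in> ?U" if "p \<in> polys F" "poly p w' \<noteq> 0" for p
      using that by (auto simp: bad_def)
    obtain b where b: "b \<in> ratfuns F w'" "b \<noteq> 0" "z ^ N * b \<in> ?U" using pow[OF z(1)] by blast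
    then obtain p r where pr: "b = poly p w' / poly r w'" "p \<in> polys F" "r \<in> polys F"
      by (auto simp: ratfuns_def)
    then have "poly p w' \<noteq> 0" "poly r w' \<noteq> 0" using b(2) by auto
    then have "b \<in> ?U" unfolding pr(1) divide_inverse
      using * pr(2,3) by (intro ring_units_mult[OF R] ring_units_inverse)
    then have "inverse b \<in> ?U" by (rule ring_units_inverse)
    then have "z ^ N * b * inverse b \<in> ?U" by (rule ring_units_mult[OF R b(3)])
    then have "z ^ N \<in> ?U" using b(2) by (simp add: mult.assoc)
    then show False using ring_units_powerD[OF A N z(1)] zA by simp
  qed
  then have "\<exists>k d. bad d \<and> degree d = k" by blast
  then obtain k where k: "\<exists>d. bad d \<and> degree d = k" "\<forall>j<k. \<not> (\<exists>d. bad d \<and> degree d = j)"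
    using exists_least_iff[of "\<lambda>k. \<exists>d. bad d \<and> degree d = k"] by blast
  then obtain d where "bad d" "degree d = k" by blast
  then have d: "bad d" "\<And>p. p \<in> polys F \<Longrightarrow> degree p < degree d \<Longrightarrow> poly p w' \<noteq> 0 \<Longrightarrow> poly p w' \<in> ?U"
    using k(2) by (auto simp: bad_def)
  let ?d = "poly d w'"
  have dA: "?d \<in> A" using d polys_mono[OF FA] R w'(1) by (intro poly_in_subring) (auto simp: bad_def)
  have disc: "\<exists>i::nat. poly p w' / ?d ^ i \<in> ?U" if "p \<in> polys F" "poly p w' \<noteq> 0" for p
  proof (rule valuation_ring_ratfuns_discrete[OF A F FA w'(1) _ _ _ _ that])
    show "d \<in> polys F" "?d \<noteq> 0" "?d \<notin> ?U" using d(1) by (simp_all add: bad_def)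
  qed (rule d(2))
  have "\<exists>k. a ^ N / ?d powi k \<in> ?U" if a: "a \<noteq> 0" for a
  proof -
    obtain b where b: "b \<in> ratfuns F w'" "b \<noteq> 0" "a ^ N * b \<in> ?U" using pow[OF a] by blast
    then obtain p r where pr: "b = poly p w' / poly r w'" "p \<in> polys F" "r \<in> polys F"
      by (auto simp: ratfuns_def)
    then have nz: "poly p w' \<noteq> 0" "poly r w' \<noteq> 0" using b(2) by auto
    obtain i where i: "poly p w' / ?d ^ i \<in> ?U" using disc[OF pr(2) nz(1)] by blast
    obtain j where j: "poly r w' / ?d ^ j \<in> ?U" using disc[OF pr(3) nz(2)] by blast
    have "(a ^ N * b) * inverse (poly p w' / ?d ^ i) * (poly r w' / ?d ^ j) \<in> ?U"
      by (rule ring_units_mult[OF R ring_units_mult[OF R b(3) ring_units_inverse[OF i]] j])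
    also have "(a ^ N * b) * inverse (poly p w' / ?d ^ i) * (poly r w' / ?d ^ j) = a ^ N / ?d powi (int j - int i)"
    proof -
      have "(x * (p / r)) * inverse (p / e) * (r / f) = x / (f / e)"
        if "p \<noteq> 0" "r \<noteq> 0" "e \<noteq> 0" "f \<noteq> 0" for x p r e f :: 'k
        using that by (simp add: field_simps)
      moreover have "?d \<noteq> 0" using d(1) by (simp add: bad_def)
      ultimately show ?thesis using nz unfolding pr(1) by (simp add: power_int_diff)
    qed
    finally show ?thesis by blast
  qed
  moreover have "?d \<noteq> 0" "inverse ?d \<notin> A" using d(1) dA by (auto simp: bad_def ring_units_def)
  ultimately obtain Q where "place F Q" "\<forall>a. a \<noteq> 0 \<longrightarrow> (Q a \<ge> 0 \<longleftrightarrow> a \<in> A)"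
    using place_of_valuation_ring[OF A F FA dA _ _ N] by blast
  then show ?thesis using z(1) zA by (metis not_le)
qed

text \<open>Clearing denominators in z = p(1/z) gives z^(deg p + 1) as the value at z of the
  reflected polynomial. Its constant term is the leading coefficient of p, so that value is a unit
  at v, while z^(deg p + 1) vanishes there.\<close>

lemma zero_not_in_adjoin_inverse:
  assumes F: "is_subfield F" and v: "place F v" and z: "v z > 0"
  shows "z \<notin> adjoin F (inverse z)"
proof
  note R = subfield_subring[OF F]
  assume "z \<in> adjoin F (inverse z)"
  then obtain p where p: "p \<in> polys F" "z = poly p (inverse z)" by (auto simp: adjoin_def)
  have z0: "z \<noteq> 0" using z v by auto
  have "v (poly (reflect_poly p) z) = 0"
  proof (rule place_poly_unit[OF F v subring_0[OF R]])
    show "reflect_poly p \<in> polys F" using p R by (auto simp: polys_def coeff_reflect_poly subring_0)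
    show "poly (reflect_poly p) 0 \<noteq> 0" using p z0 by auto
  qed (use z in simp)
  moreover have "poly (reflect_poly p) z = z ^ Suc (degree p)"
    using p z0 by (simp add: poly_reflect_poly_nz mult.commute)
  ultimately show False using z place_power[OF v, of z "Suc (degree p)"] by (simp del: power_Suc)
qed

section \<open>Finite fields and roots of unity\<close>

lemma place_prod:
  assumes v: "place F v" and "\<And>i. i \<in> I \<Longrightarrow> f i \<noteq> 0"
  shows "v (prod f I) = (\<Sum>i\<in>I. v (f i))"
  using assms(2)
  by (induction I rule: infinite_finite_induct) (use v in \<open>auto simp: place_mult\<close>)

lemma finite_field_power_card:
  assumes F: "is_subfield F" "finite F" and a: "a \<in> F" "a \<noteq> 0"
  shows "a ^ (card F - 1) = 1"
proof -
  let ?G = "F - {0}"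
  have inj: "inj_on ((*) a) ?G" using a by (auto simp: inj_on_def)
  have "(*) a ` ?G = ?G"
    using F a by (intro card_subset_eq) (auto simp: card_image[OF inj] is_subfield_def)
  then have "prod id ?G = prod ((*) a) ?G"
    using prod.reindex[OF inj, of id] by simp
  also have "\<dots> = a ^ card ?G * prod id ?G" by (simp add: prod.distrib)
  finally have "a ^ card ?G * prod id ?G = 1 * prod id ?G" by simp
  moreover have "prod id ?G \<noteq> 0" using F by (simp add: prod_zero_iff)
  ultimately have "a ^ card ?G = 1" by (metis mult_cancel_right)
  then show ?thesis using F subring_0[OF subfield_subring[OF F(1)]] by (simp add: card_Diff_singleton)
qed

lemma finite_field_of_nat_card:
  fixes F :: "'k::field set"
  assumes F: "is_subfield F" "finite F"
  shows "of_nat (card F) = (0 :: 'k)"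
proof -
  have R: "subring_of F" using F(1) by (rule subfield_subring)
  have inj: "inj_on (\<lambda>a. a + 1) F" by (auto simp: inj_on_def)
  have "(\<lambda>a. a + 1) ` F = F"
    using F R by (intro card_subset_eq) (auto simp: card_image[OF inj] intro: subring_add subring_1)
  then have "sum id F = (\<Sum>a\<in>F. a + 1)"
    using sum.reindex[OF inj, of id] by simp
  also have "\<dots> = sum id F + of_nat (card F)" by (simp add: sum.distrib)
  finally show ?thesis by simp
qed

text \<open>As polynomials in w both sides are monic of degree \<open>card F\<close> and vanish on
  F, so their difference has more roots than its degree allows.\<close>

lemma finite_field_prod_linear:
  fixes F :: "'k::field set"
  assumes F: "is_subfield F" "finite F" and card: "card F > 1"
  shows "(\<Prod>a\<in>F. w - a) = w ^ card F - w"
proof -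
  define p where "p = (\<Prod>a\<in>F. [:-a, 1:])"
  define r :: "'k poly" where "r = monom 1 (card F) - monom 1 1"
  have dp: "degree p = card F"
    unfolding p_def by (subst degree_prod_eq_sum_degree) auto
  have lp: "lead_coeff p = 1" unfolding p_def by (simp add: lead_coeff_prod)
  have "degree (p - r) < card F"
  proof (rule degree_lessI)
    show "\<forall>k\<ge>card F. coeff (p - r) k = 0"
      using lp dp card by (auto simp: r_def coeff_eq_0 le_less)
  qed (use card in auto)
  moreover have "poly (p - r) a = 0" if a: "a \<in> F" for a
  proof -
    have "a * a ^ (card F - 1) = a" using finite_field_power_card[OF F a] by (cases "a = 0") auto
    then have "a ^ card F = a" using card by (metis Suc_diff_1 less_trans power_Suc zero_less_one)
    moreover have "poly p a = 0" using a F by (auto simp: p_def poly_prod)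
    ultimately show ?thesis by (simp add: r_def poly_monom)
  qed
  then have "card F \<le> card {a. poly (p - r) a = 0}" if "p - r \<noteq> 0"
    using that poly_roots_finite[OF that] by (intro card_mono) auto
  ultimately have "p - r = 0" using card_poly_roots_bound[of "p - r"] by fastforce
  then have "poly p w = poly r w" by simp
  then show ?thesis by (simp add: p_def r_def poly_prod poly_monom)
qed

definition roots_of_unity_in :: "'k::field set \<Rightarrow> nat \<Rightarrow> 'k set" where
  "roots_of_unity_in F n = {z \<in> F. z ^ n = 1}"

lemma monom_minus_1_nonzero: "n > 0 \<Longrightarrow> monom (1::'k::field) n - 1 \<noteq> 0"
proof
  assume "n > 0" "monom (1::'k) n - 1 = 0"
  from arg_cong[OF this(2), of "\<lambda>p. coeff p 0"] this(1) show False by simp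
qed

text \<open>X^(nl) - 1 is (X^n - 1) times a cofactor \<open>s\<close> with at most n(l - 1) roots.
  All nl nonzero elements of F are roots of the product, so at least n of them are roots of X^n -
  1.\<close>

lemma card_roots_of_unity_in:
  assumes F: "is_subfield F" "finite F" and n: "n > 0" "card F - 1 = n * l" "card F > 1"
  shows "card (roots_of_unity_in F n) = n"
proof (rule antisym)
  let ?p = "monom 1 n - 1 :: 'a poly"
  have p0: "?p \<noteq> 0"
    using n(1) by (rule monom_minus_1_nonzero)
  have "degree ?p \<le> n" by (intro degree_diff_le) (auto simp: degree_monom_le)
  have "roots_of_unity_in F n \<subseteq> {z. poly ?p z = 0}"
    by (auto simp: roots_of_unity_in_def poly_monom)
  then show "card (roots_of_unity_in F n) \<le> n"
    using card_mono[OF poly_roots_finite[OF p0]] card_poly_roots_bound[OF p0] \<open>degree ?p \<le> n\<close>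
    by (meson order.trans)
  define s where "s = (\<Sum>i<l. monom (1::'a) (n * i))"
  have l: "l > 0" using n by (cases l) auto
  have ev: "poly s z * (z ^ n - 1) = z ^ (n * l) - 1" for z
    using power_diff_sumr2[of "z ^ n" l 1]
    by (simp add: s_def poly_sum poly_monom power_mult mult.commute[of _ "z ^ n - 1"])
  have "coeff s 0 = (\<Sum>i<l. if i = 0 then 1 else 0)"
    unfolding s_def coeff_sum using n(1) by (intro sum.cong) (auto simp: coeff_monom)
  also have "\<dots> = 1" using l by simp
  finally have s0: "s \<noteq> 0" by auto
  have "degree s \<le> n * (l - 1)"
    unfolding s_def by (intro degree_sum_le) (auto intro!: order.trans[OF degree_monom_le])
  then have cs: "card {z. poly s z = 0} \<le> n * (l - 1)"
    using card_poly_roots_bound[OF s0] by simp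
  have "F - {0} \<subseteq> roots_of_unity_in F n \<union> {z. poly s z = 0}"
  proof
    fix z assume z: "z \<in> F - {0}"
    then have "poly s z * (z ^ n - 1) = 0"
      unfolding ev using finite_field_power_card[OF F] n(2) by auto
    then show "z \<in> roots_of_unity_in F n \<union> {z. poly s z = 0}"
      using z by (auto simp: roots_of_unity_in_def)
  qed
  then have "card (F - {0}) \<le> card (roots_of_unity_in F n \<union> {z. poly s z = 0})"
    using F poly_roots_finite[OF s0] by (intro card_mono) (auto simp: roots_of_unity_in_def)
  also have "\<dots> \<le> card (roots_of_unity_in F n) + card {z. poly s z = 0}"
    by (rule card_Un_le)
  finally have "card F - 1 \<le> card (roots_of_unity_in F n) + n * (l - 1)"
    using cs F subring_0[OF subfield_subring[OF F(1)]] by (simp add: card_Diff_singleton)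
  moreover have "n * l = n + n * (l - 1)" using l by (cases l) auto
  ultimately show "n \<le> card (roots_of_unity_in F n)" using n by simp
qed

text \<open>X^k - 1 has too few roots to contain the whole group, so some u has u^k \<noteq> 1.
  Replacing z by uz multiplies the sum by u^k without changing it.\<close>

lemma sum_roots_of_unity_in:
  assumes F: "is_subfield F" "finite F" and card: "card (roots_of_unity_in F n) = n"
    and k: "0 < k" "k < n"
  shows "(\<Sum>z\<in>roots_of_unity_in F n. z ^ k) = 0"
proof -
  let ?M = "roots_of_unity_in F n"
  have fin: "finite ?M" using F by (simp add: roots_of_unity_in_def)
  let ?p = "monom 1 k - 1 :: 'a poly"
  have p0: "?p \<noteq> 0"
    using k(1) by (rule monom_minus_1_nonzero)
  have "degree ?p \<le> k" by (intro degree_diff_le) (auto simp: degree_monom_le)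
  then have "card {z. poly ?p z = 0} < card ?M" using card_poly_roots_bound[OF p0] k card by linarith
  then have "\<not> ?M \<subseteq> {z. poly ?p z = 0}" using card_mono[OF poly_roots_finite[OF p0], of ?M] by linarith
  then obtain u where u: "u \<in> ?M" "u ^ k \<noteq> 1" by (auto simp: poly_monom)
  have u0: "u \<noteq> 0" using u k by (auto simp: roots_of_unity_in_def power_0_left split: if_splits)
  have inj: "inj_on ((*) u) ?M" using u0 by (auto simp: inj_on_def)
  have "(*) u ` ?M = ?M"
    by (rule card_subset_eq[OF fin _ card_image[OF inj]])
      (use u F in \<open>auto simp: roots_of_unity_in_def power_mult_distrib is_subfield_def\<close>)
  then have "(\<Sum>z\<in>?M. z ^ k) = (\<Sum>z\<in>?M. (u * z) ^ k)"
    using sum.reindex[OF inj, of "\<lambda>z. z ^ k"] by simp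
  also have "\<dots> = u ^ k * (\<Sum>z\<in>?M. z ^ k)" by (simp add: power_mult_distrib sum_distrib_left)
  finally have "(1 - u ^ k) * (\<Sum>z\<in>?M. z ^ k) = 0" by (simp add: algebra_simps)
  then show ?thesis using u by simp
qed

lemma sum_roots_of_unity_in_orthogonal:
  assumes F: "is_subfield F" "finite F" and card: "card (roots_of_unity_in F n) = n"
    and ij: "i < n" "j < n"
  shows "(\<Sum>z\<in>roots_of_unity_in F n. inverse z ^ i * z ^ j) = (if i = j then of_nat n else 0)"
proof -
  let ?M = "roots_of_unity_in F n"
  have nz: "z \<noteq> 0" if "z \<in> ?M" for z
    using that ij by (auto simp: roots_of_unity_in_def power_0_left split: if_splits)
  have inv: "inverse z ^ i = z ^ (n - i)" if "z \<in> ?M" for z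
  proof -
    have "z ^ i * z ^ (n - i) = 1"
      using that ij by (simp add: roots_of_unity_in_def flip: power_add)
    then show ?thesis unfolding power_inverse by (rule inverse_unique)
  qed
  consider "i = j" | "i < j" | "j < i" by linarith
  then show ?thesis
  proof cases
    case 1
    then have "(\<Sum>z\<in>?M. inverse z ^ i * z ^ j) = (\<Sum>z\<in>?M. 1)"
      using nz by (intro sum.cong) (auto simp flip: power_mult_distrib)
    then show ?thesis using 1 card by simp
  next
    case 2
    have "(\<Sum>z\<in>?M. inverse z ^ i * z ^ j) = (\<Sum>z\<in>?M. z ^ (j - i))"
      using nz 2 by (intro sum.cong) (auto simp: power_diff power_inverse divide_inverse)
    then show ?thesis using 2 ij sum_roots_of_unity_in[OF F card, of "j - i"] by simp
  next
    case 3
    have "(\<Sum>z\<in>?M. inverse z ^ i * z ^ j) = (\<Sum>z\<in>?M. z ^ (n - i + j))"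
      using inv by (intro sum.cong) (auto simp: power_add)
    then show ?thesis using 3 ij sum_roots_of_unity_in[OF F card, of "n - i + j"] by simp
  qed
qed

text \<open>The coefficients b are the same for all n-th roots Y of r; this makes the Kummer
  automorphisms well defined.\<close>
lemma poly_reduce_power:
  assumes W: "subring_of W" and r: "r \<in> W" and n: "n > 0" and p: "p \<in> polys W"
  shows "\<exists>b. (\<forall>k<n. b k \<in> W) \<and> (\<forall>Y. Y ^ n = r \<longrightarrow> poly p Y = (\<Sum>k<n. b k * Y ^ k))"
  using p
proof (induction p)
  case 0
  then show ?case by (intro exI[of _ "\<lambda>_. 0"]) (use subring_0[OF W] in auto)
next
  case (pCons a p)
  then have a: "a \<in> W" "p \<in> polys W" by (auto dest: polys_pConsD)
  with pCons obtain b where b: "\<And>k. k < n \<Longrightarrow> b k \<in> W"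
    "\<And>Y. Y ^ n = r \<Longrightarrow> poly p Y = (\<Sum>k<n. b k * Y ^ k)" by blast
  obtain n' where n': "n = Suc n'" using n by (cases n) auto
  \<comment> \<open>Multiplication by Y shifts the coefficients, and Y^n = r sends the top one to
    the constant term.\<close>
  define b' where "b' k = (case k of 0 \<Rightarrow> a + b n' * r | Suc k' \<Rightarrow> b k')" for k
  have "b' k \<in> W" if "k < n" for k
    using that a b r W n' by (auto simp: b'_def intro!: subring_add subring_mult split: nat.splits)
  moreover have "poly (pCons a p) Y = (\<Sum>k<n. b' k * Y ^ k)" if Y: "Y ^ n = r" for Y
  proof -
    have "poly (pCons a p) Y = a + (\<Sum>k<n'. b k * Y ^ Suc k) + b n' * r"
      using b(2)[OF Y] Y unfolding n'
      by (simp add: sum_distrib_left algebra_simps)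
    also have "\<dots> = (\<Sum>k<Suc n'. b' k * Y ^ k)"
      by (subst sum.lessThan_Suc_shift) (simp add: b'_def algebra_simps)
    finally show ?thesis by (simp add: n')
  qed
  ultimately show ?case by blast
qed

text \<open>Cancelling a^l, where l is the first index with a nonzero coefficient, leaves a relation
  with nonzero constant term, which is solved for 1/a.\<close>

lemma algebraic_inverse_mem:
  assumes S: "subring_of S" and W: "is_subfield W" "W \<subseteq> S" and a: "a \<in> S" "a \<noteq> 0"
    and c: "\<And>j. j \<le> n \<Longrightarrow> c j \<in> W" "\<exists>j\<le>n. c j \<noteq> 0" "(\<Sum>j\<le>n. c j * a ^ j) = 0"
  shows "inverse a \<in> S"
proof -
  obtain l where l: "l \<le> n" "c l \<noteq> 0" "\<And>j. j < l \<Longrightarrow> c j = 0"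
    using exists_least_iff[of "\<lambda>j. j \<le> n \<and> c j \<noteq> 0"] c(2) by (metis le_trans nat_less_le)
  have "(\<Sum>j=l..n. c j * a ^ j) = 0"
    unfolding c(3)[symmetric] by (intro sum.mono_neutral_left) (use l(3) in \<open>auto simp: not_le\<close>)
  then have "c l * a ^ l + (\<Sum>j=Suc l..n. c j * a ^ j) = 0"
    using l(1) by (simp add: sum.atLeast_Suc_atMost)
  moreover have "(\<Sum>j=Suc l..n. c j * a ^ j) = a ^ Suc l * (\<Sum>j=Suc l..n. c j * a ^ (j - Suc l))"
    unfolding sum_distrib_left by (intro sum.cong) (auto simp flip: power_add simp del: power_Suc)
  ultimately have "a ^ l * (c l + a * (\<Sum>j=Suc l..n. c j * a ^ (j - Suc l))) = 0"
    by (simp add: distrib_left mult_ac)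
  then have "c l + a * (\<Sum>j=Suc l..n. c j * a ^ (j - Suc l)) = 0" using a by simp
  then have "inverse a = - inverse (c l) * (\<Sum>j=Suc l..n. c j * a ^ (j - Suc l))"
    using a l(2) by (simp add: field_simps eq_neg_iff_add_eq_0)
  moreover have "c l \<in> W" using c l by auto
  then have "inverse (c l) \<in> S" using W by (auto simp: is_subfield_def)
  ultimately show ?thesis
    using S W a c by (auto intro!: subring_mult subring_uminus subring_sum subring_power)
qed

section \<open>The Kummer extension\<close>

text \<open>n - 1 stands for q. Keeping w as a parameter makes the last two equations symmetric in x
  and w, so the same locale serves after a change of coordinates.\<close>

locale kummer_curve =
  fixes F :: "'k::field set" and x y w :: 'k and m n :: nat
  assumes F: "is_subfield F" "finite F" and card_F: "card F = (n - 1) ^ 2"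
    and m: "m > 1" and n_def: "n = 3 * m"
    and generated: "generated_by F x y"
    and nonzero: "x \<noteq> 0" "y \<noteq> 0" "w \<noteq> 0"
    and y3: "y ^ 3 = x * w" and fermat: "w ^ m + x ^ m + 1 = 0"
begin

abbreviation "W \<equiv> ratfuns F w"

lemma n_pos: "n > 0" and card_gt_1: "card F > 1" and card_minus_1: "card F - 1 = n * (n - 2)"
proof -
  obtain k where k: "n = k + 2" using m n_def by (intro that[of "n - 2"]) simp
  show "n > 0" "card F > 1" "card F - 1 = n * (n - 2)"
    unfolding card_F k by (auto simp: power2_eq_square algebra_simps)
    (use m n_def k in auto)
qed

text \<open>q^2 = \<open>card F\<close> vanishes in K, hence q does. Besides the averaging, this
  yields that m is nonzero in K, so the roots of X^m + 1 are simple.\<close>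

lemma of_nat_n: "of_nat n = (1::'k)"
proof -
  have "of_nat ((n - 1) ^ 2) = (0::'k)" using finite_field_of_nat_card[OF F] card_F by simp
  then have "of_nat (n - 1) = (0::'k)" by (simp only: of_nat_power power_eq_0_iff)
  moreover have "n = Suc (n - 1)" using n_pos by simp
  ultimately show ?thesis by (metis add_0_right of_nat_Suc)
qed

lemma of_nat_m: "of_nat m \<noteq> (0::'k)"
  using of_nat_n unfolding n_def by (metis mult_zero_right of_nat_mult zero_neq_one)

lemma W_subfield: "is_subfield W" and W_subring: "subring_of W" and w_in_W: "w \<in> W"
  and F_subset_W: "F \<subseteq> W"
  using subfield_ratfuns[OF F(1)] ratfuns_gen[OF F(1)] ratfuns_const[OF F(1)]
  by (auto intro: subfield_subring)

lemma y_power_n: "y ^ n = - (w ^ m * (w ^ m + 1))"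
proof -
  have "y ^ n = x ^ m * w ^ m" by (simp add: n_def power_mult y3 power_mult_distrib)
  moreover have "x ^ m = - (w ^ m + 1)" using fermat by (simp add: eq_neg_iff_add_eq_0 algebra_simps)
  ultimately show ?thesis by (simp add: algebra_simps)
qed

lemma y_power_n_in_W: "y ^ n \<in> W"
  unfolding y_power_n using W_subring w_in_W
  by (intro subring_uminus subring_mult subring_add subring_power subring_1)

lemma y_value: "place F Q \<Longrightarrow> 3 * Q y = Q x + Q w"
  using place_power[of F Q y 3] place_mult[of F Q x w] nonzero by (simp add: y3)

text \<open>n + 1 powers of a lie in the W-span of n powers of y. The bound on the degree does not
  depend on a, as \<open>ex_pole\<close> requires.\<close>

lemma algebraic_over_W:
  assumes "a \<in> adjoin W y"
  shows "\<exists>c. (\<forall>j\<le>n. c j \<in> W) \<and> (\<exists>j\<le>n. c j \<noteq> 0) \<and> (\<Sum>j\<le>n. c j * a ^ j) = 0"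
proof -
  have "\<exists>b. (\<forall>k<n. b k \<in> W) \<and> a ^ j = (\<Sum>k<n. b k * y ^ k)" for j
  proof -
    have "a ^ j \<in> adjoin W y" using assms subring_adjoin[OF W_subring] by (rule subring_power[rotated])
    then obtain p where p: "p \<in> polys W" "a ^ j = poly p y" by (auto simp: adjoin_def)
    obtain b where "\<forall>k<n. b k \<in> W" "\<forall>Y. Y ^ n = y ^ n \<longrightarrow> poly p Y = (\<Sum>k<n. b k * Y ^ k)"
      using poly_reduce_power[OF W_subring y_power_n_in_W n_pos p(1)] by (elim exE conjE)
    then show ?thesis unfolding p(2) by (intro exI[of _ b] conjI) simp_all
  qed
  then have "\<forall>j. \<exists>b. (\<forall>k<n. b k \<in> W) \<and> a ^ j = (\<Sum>k<n. b k * y ^ k)" by (rule allI)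
  from choice[OF this] obtain B
    where "\<forall>j. (\<forall>k<n. B j k \<in> W) \<and> a ^ j = (\<Sum>k<n. B j k * y ^ k)" by (rule exE)
  then have B: "\<And>j k. k < n \<Longrightarrow> B j k \<in> W" "\<And>j. a ^ j = (\<Sum>k<n. B j k * y ^ k)" by simp_all
  have "\<exists>c. (\<forall>j\<in>{..n}. c j \<in> W) \<and> (\<exists>j\<in>{..n}. c j \<noteq> 0) \<and> (\<Sum>j\<in>{..n}. c j * a ^ j) = 0"
    by (rule subfield_dependent[OF W_subfield, of "{..n}" n _ B]) (use B in simp_all)
  then show ?thesis by (simp add: Bex_def Ball_def)
qed

text \<open>W[y] is closed under inverses because its elements are algebraic over W, and it contains
  x = y^3/w.\<close>

lemma adjoin_W_y: "adjoin W y = UNIV"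
proof -
  let ?L = "adjoin W y"
  note L = subring_adjoin[OF W_subring, of y]
  have sub: "W \<subseteq> ?L" using adjoin_subset[OF W_subring] .
  have inv: "inverse a \<in> ?L" if a: "a \<in> ?L" for a
  proof (cases "a = 0")
    case False
    obtain c where c: "\<forall>j\<le>n. c j \<in> W" "\<exists>j\<le>n. c j \<noteq> 0" "(\<Sum>j\<le>n. c j * a ^ j) = 0"
      using algebraic_over_W[OF a] by blast
    show ?thesis
      by (rule algebraic_inverse_mem[OF L W_subfield sub a False _ c(2,3)]) (use c(1) in blast)
  qed (use L subring_0 in auto)
  have "is_subfield ?L"
    using inv L by (auto simp: is_subfield_def subring_of_def)
  moreover have "y \<in> ?L" using adjoin_mem[OF W_subring] .
  moreover have "x = y ^ 3 * inverse w" using y3 nonzero by simp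
  then have "x \<in> ?L"
    using inv[of w] sub w_in_W adjoin_mem[OF W_subring] L by (auto intro!: subring_mult subring_power)
  ultimately show ?thesis using generated sub F_subset_W unfolding generated_by_def by blast
qed

lemma expansion: "\<exists>b. (\<forall>k<n. b k \<in> W) \<and> a = (\<Sum>k<n. b k * y ^ k)"
proof -
  obtain p where p: "p \<in> polys W" "a = poly p y" using adjoin_W_y by (auto simp: adjoin_def)
  obtain b where "\<forall>k<n. b k \<in> W" "\<forall>Y. Y ^ n = y ^ n \<longrightarrow> poly p Y = (\<Sum>k<n. b k * Y ^ k)"
    using poly_reduce_power[OF W_subring y_power_n_in_W n_pos p(1)] by (elim exE conjE)
  then show ?thesis unfolding p(2) by (intro exI[of _ b] conjI) simp_all
qed

lemma ex_pole_of_zero: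
  assumes "place F Q" "Q z > 0"
  shows "\<exists>Q. place F Q \<and> Q z < 0"
proof (rule ex_pole[OF F(1)])
  show "\<exists>c. (\<forall>j\<le>n. c j \<in> W) \<and> (\<exists>j\<le>n. c j \<noteq> 0) \<and> (\<Sum>j\<le>n. c j * a ^ j) = 0" for a
    by (rule algebraic_over_W) (simp add: adjoin_W_y)
  show "z \<noteq> 0" using assms by auto
  show "z \<notin> adjoin F (inverse z)" using zero_not_in_adjoin_inverse[OF F(1)] assms .
qed

text \<open>-x^m = w^m + 1 has value 3m Q(y) = n Q(y). Since w^m + 1 divides the product of all w -
  a with a in F, some w - c vanishes at Q; as c is a simple root of X^m + 1, that factor carries the
  whole value.\<close>

lemma zero_of_x:
  assumes Q: "place F Q" and x: "Q x > 0"
  shows "Q w = 0" "Q y > 0" "Q x = 3 * Q y"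
    and "\<exists>c\<in>F. c ^ m + 1 = 0 \<and> Q (w - c) = int n * Q y"
proof -
  have xm: "x ^ m = - (w ^ m + 1)" and wm: "w ^ m = - (1 + x ^ m)"
    using fermat by (simp_all add: eq_neg_iff_add_eq_0 algebra_simps)
  have xmv: "Q (x ^ m) = int m * Q x" "Q (x ^ m) > 0" using x m by (simp_all add: place_power[OF Q])
  have "Q (w ^ m) = 0"
    unfolding wm place_uminus[OF Q] using place_add_eq(2)[OF Q, of 1 "x ^ m"] Q xmv by simp
  then show w0: "Q w = 0" using m by (simp add: place_power[OF Q])
  show y: "Q x = 3 * Q y" using y_value[OF Q] w0 by simp
  then show "Q y > 0" using x by simp
  have wm1: "Q (w ^ m + 1) = int n * Q y"
    using xmv y unfolding xm place_uminus[OF Q] n_def by simp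
  have pos: "Q (w ^ m + 1) > 0" using xmv unfolding xm place_uminus[OF Q] by simp
  have notF: "w - a \<noteq> 0" if "a \<in> F" for a
  proof
    assume "w - a = 0"
    then have "w ^ m + 1 \<in> F"
      using that subfield_subring[OF F(1)] by (auto intro!: subring_add subring_power subring_1)
    then show False using pos place_const[OF Q] by simp
  qed
  have "\<exists>c\<in>F. Q (w - c) > 0"
  proof -
    \<comment> \<open>Chosen so that \<open>card F - 1\<close> = m e. The sign (-1)^e is 1: for even
      m because e is even, for odd m because (-1)^(m e) = 1 in F.\<close>
    let ?e = "3 * (n - 2)"
    have neg1: "(- 1 :: 'k) ^ ?e = 1"
    proof (cases "even m")
      case False
      have "- 1 \<in> F" using subfield_subring[OF F(1)] by (simp add: subring_1 subring_uminus)
      from finite_field_power_card[OF F this] have "(- 1 :: 'k) ^ (m * ?e) = 1"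
        unfolding card_minus_1 n_def by (simp add: ac_simps)
      then show ?thesis using False by (simp add: power_mult)
    qed (use n_def in simp)
    have "w ^ card F - w = w * (w ^ (card F - 1) - 1)"
      using card_gt_1 by (cases "card F") (simp_all add: algebra_simps)
    also have "card F - 1 = m * ?e" unfolding card_minus_1 n_def by simp
    also have "w ^ (m * ?e) - 1 = (w ^ m) ^ ?e - (- 1) ^ ?e" unfolding neg1 by (simp add: power_mult)
    also have "\<dots> = (w ^ m + 1) * (\<Sum>i<?e. (- 1) ^ (?e - Suc i) * (w ^ m) ^ i)"
      using power_diff_sumr2[of "w ^ m" ?e "- 1"] by simp
    finally have eq: "(\<Prod>a\<in>F. w - a) = w * ((w ^ m + 1) * (\<Sum>i<?e. (- 1) ^ (?e - Suc i) * (w ^ m) ^ i))"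
      using finite_field_prod_linear[OF F card_gt_1] by simp
    let ?s = "\<Sum>i<?e. (- 1) ^ (?e - Suc i) * (w ^ m) ^ i :: 'k"
    have "(\<Prod>a\<in>F. w - a) \<noteq> 0" using notF F by (simp add: prod_zero_iff)
    then have nz: "w ^ m + 1 \<noteq> 0" "?s \<noteq> 0" unfolding eq by auto
    have "Q ?s \<ge> 0"
      by (intro place_sum_nonneg[OF Q] place_mult_nonneg[OF Q])
        (simp_all add: place_power[OF Q] place_uminus[OF Q] w0 place_1[OF Q])
    then have "Q (\<Prod>a\<in>F. w - a) > 0"
      unfolding eq using nz nonzero pos w0 by (simp add: place_mult[OF Q])
    then have "(\<Sum>a\<in>F. Q (w - a)) > 0" using place_prod[OF Q, of F "\<lambda>a. w - a"] notF by simp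
    then show ?thesis by (meson not_le sum_nonpos)
  qed
  then obtain c where c: "c \<in> F" "Q (w - c) > 0" by blast
  note R = subfield_subring[OF F(1)]
  have cm: "c ^ m + 1 = 0"
  proof (rule ccontr)
    assume nz: "c ^ m + 1 \<noteq> 0"
    have "Q (poly (monom 1 m + [:1:]) w) = 0"
      by (rule place_poly_unit(2)[OF F(1) Q c])
        (use R nz in \<open>auto intro!: polysI subring_1 simp: poly_monom\<close>)
    then show False using pos by (simp add: poly_monom)
  qed
  \<comment> \<open>The cofactor (X^m - c^m)/(X - c); its value at c is the derivative m c^(m -
    1).\<close>
  let ?p = "\<Sum>i<m. monom (c ^ (m - Suc i)) i"
  have "poly ?p c = (\<Sum>i<m. c ^ (m - 1))"
    unfolding poly_sum poly_monom by (intro sum.cong) (auto simp flip: power_add)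
  then have "poly ?p c = of_nat m * c ^ (m - 1)" by simp
  moreover have "c \<noteq> 0" using cm m by (auto simp: power_0_left)
  ultimately have pc: "poly ?p c \<noteq> 0" using of_nat_m by simp
  have "?p \<in> polys F"
    by (intro polys_sum[OF R] polys_monom[OF R] subring_power[OF R c(1)])
  note unit = place_poly_unit[OF F(1) Q c this pc]
  have "c ^ m = - 1" using cm by (simp add: eq_neg_iff_add_eq_0)
  then have "w ^ m + 1 = w ^ m - c ^ m" by simp
  also have "\<dots> = (w - c) * poly ?p w"
    by (simp add: power_diff_sumr2 poly_sum poly_monom)
  finally have "Q (w - c) = Q (w ^ m + 1)"
    using unit c notF by (simp add: place_mult[OF Q])
  then show "\<exists>c\<in>F. c ^ m + 1 = 0 \<and> Q (w - c) = int n * Q y"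
    using c cm wm1 by auto
qed

end

section \<open>Places above w = c and the Kummer group\<close>

lemma int_multiple_nonneg:
  assumes "(u::int) > 0" "v = j * u" "v > - u"
  shows "v \<ge> 0"
proof -
  have "(- 1) * u < j * u" using assms by simp
  then have "j \<ge> 0" using assms(1) by (simp only: mult_less_cancel_right_pos)
  then show ?thesis using assms by simp
qed

locale kummer_point = kummer_curve F x y w m n
  for F :: "'k::field set" and x y w and m n :: nat +
  fixes c :: 'k and P :: "'k \<Rightarrow> int"
  assumes P: "place F P" and c: "c \<in> F" "c ^ m + 1 = 0" and P_pos: "P (w - c) > 0"
begin

lemma residue_unique:
  assumes Q: "place F Q" and "a \<in> F" "b \<in> F" "Q (w - a) > 0" "Q (w - b) > 0"
  shows "a = b"
proof (rule ccontr)
  assume "a \<noteq> b"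
  note R = subfield_subring[OF F(1)]
  have "[:- b, 1:] \<in> polys F" using R assms by (intro polys_pCons polysI subringD)
  then have "Q (poly [:- b, 1:] w) = 0"
    using \<open>a \<noteq> b\<close> by (intro place_poly_unit[OF F(1) Q assms(2,4)]) auto
  then show False using assms by simp
qed

text \<open>w - c divides w^m + 1 = -x^m, so every place above w = c is a zero of x. The root
  supplied by \<open>zero_of_x\<close> is c, as w has only one residue at Q.\<close>

lemma above_c:
  assumes Q: "place F Q" and pos: "Q (w - c) > 0"
  shows "Q y > 0" "Q x = 3 * Q y" "Q w = 0" "Q (w - c) = int n * Q y"
proof -
  have "Q w \<ge> 0"
    using place_add_nonneg[OF Q, of "w - c" c] pos place_const[OF Q c(1)] by simp
  then have s: "Q (\<Sum>i<m. c ^ (m - Suc i) * w ^ i) \<ge> 0"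
    by (intro place_sum_nonneg[OF Q] place_mult_nonneg[OF Q])
      (simp_all add: place_power[OF Q] place_const[OF Q c(1)])
  have "c ^ m = - 1" using c(2) by (simp add: eq_neg_iff_add_eq_0)
  then have "w ^ m + 1 = (w - c) * (\<Sum>i<m. c ^ (m - Suc i) * w ^ i)"
    by (simp flip: power_diff_sumr2)
  moreover have "x ^ m = - (w ^ m + 1)"
    using fermat by (simp add: eq_neg_iff_add_eq_0 algebra_simps)
  ultimately have xm: "x ^ m = - ((w - c) * (\<Sum>i<m. c ^ (m - Suc i) * w ^ i))" by simp
  moreover have "x ^ m \<noteq> 0" using nonzero by simp
  ultimately have "Q (x ^ m) > 0"
    using s pos by (simp add: place_uminus[OF Q] place_mult[OF Q])
  then have "Q x > 0" by (simp add: place_power[OF Q] zero_less_mult_iff)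
  note z = zero_of_x[OF Q this]
  show "Q y > 0" "Q x = 3 * Q y" "Q w = 0" by (rule z)+
  obtain c' where c': "c' \<in> F" "Q (w - c') = int n * Q y" using z(4) by blast
  then have "Q (w - c') > 0" using z(2) n_pos by simp
  then have "c' = c" using residue_unique[OF Q c'(1) c(1) _ pos] by simp
  then show "Q (w - c) = int n * Q y" using c' by simp
qed

text \<open>Above w = c the k-th term of an expansion has value congruent to k modulo n, so no two
  terms can cancel.\<close>
lemma expansion_value:
  assumes b: "\<And>k. k < n \<Longrightarrow> b k \<in> W" and nz: "\<exists>k<n. b k \<noteq> 0"
  shows "\<exists>k<n. b k \<noteq> 0 \<and> (\<exists>K. \<forall>Q. place F Q \<and> Q (w - c) > 0 \<longrightarrow>
    (\<Sum>k<n. b k * y ^ k) \<noteq> 0 \<and> Q (\<Sum>k<n. b k * y ^ k) = Q y * K \<and> Q (b k * y ^ k) = Q y * K)"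
proof -
  define I where "I = {k. k < n \<and> b k \<noteq> 0}"
  have I: "finite I" "I \<noteq> {}" using nz by (auto simp: I_def)
  have "\<forall>k\<in>I. \<exists>j. \<forall>Q. place F Q \<and> Q (w - c) > 0 \<longrightarrow> Q (b k) = j * Q (w - c)"
  proof
    fix k assume "k \<in> I"
    then show "\<exists>j. \<forall>Q. place F Q \<and> Q (w - c) > 0 \<longrightarrow> Q (b k) = j * Q (w - c)"
      using b by (intro place_ratfun[OF F(1) c(1)]) (auto simp: I_def)
  qed
  from bchoice[OF this] obtain j where
    j: "\<forall>k\<in>I. \<forall>Q. place F Q \<and> Q (w - c) > 0 \<longrightarrow> Q (b k) = j k * Q (w - c)" by (rule exE)
  \<comment> \<open>The value of the k-th term in units of Q y: w - c contributes n units per order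
    and y contributes one. It is the same at all places above w = c.\<close>
  define h where "h k = int n * j k + int k" for k
  have "h k mod int n = int k" if "k \<in> I" for k
    using that by (simp add: h_def I_def)
  then have inj: "inj_on h I" by (metis inj_onI of_nat_eq_iff)
  have "Min (h ` I) \<in> h ` I" using I by (intro Min_in) auto
  then obtain k0 where k0: "k0 \<in> I" "Min (h ` I) = h k0" by auto
  have tv: "b k * y ^ k \<noteq> 0 \<and> Q (b k * y ^ k) = Q y * h k"
    if "place F Q" "Q (w - c) > 0" "k \<in> I" for Q k
  proof -
    have bk: "b k \<noteq> 0" using that by (simp add: I_def)
    have "Q (b k) = j k * (int n * Q y)" using j that above_c(4) by auto
    then show ?thesis
      using bk nonzero that(1) by (simp add: place_mult place_power h_def algebra_simps)
  qed
  have "(\<Sum>k<n. b k * y ^ k) = (\<Sum>k\<in>I. b k * y ^ k)"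
    by (intro sum.mono_neutral_right) (auto simp: I_def)
  then have "(\<Sum>k<n. b k * y ^ k) \<noteq> 0 \<and> Q (\<Sum>k<n. b k * y ^ k) = Q y * h k0"
    if Q: "place F Q" "Q (w - c) > 0" for Q
    using place_sum_distinct[OF Q(1) I inj above_c(1)[OF Q] tv[OF Q]] k0(2) by simp
  then have "\<forall>Q. place F Q \<and> Q (w - c) > 0 \<longrightarrow> (\<Sum>k<n. b k * y ^ k) \<noteq> 0 \<and>
      Q (\<Sum>k<n. b k * y ^ k) = Q y * h k0 \<and> Q (b k0 * y ^ k0) = Q y * h k0"
    using tv k0(1) by blast
  then show ?thesis using k0(1) by (auto simp: I_def)
qed

text \<open>Linear independence of the powers of y over W, read off from the values at P.\<close>

lemma expansion_zero:
  assumes "\<And>k. k < n \<Longrightarrow> b k \<in> W" "(\<Sum>k<n. b k * y ^ k) = 0" "k < n"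
  shows "b k = 0"
proof (rule ccontr)
  assume "b k \<noteq> 0"
  then have "\<exists>k<n. b k \<noteq> 0" using assms(3) by blast
  from expansion_value[OF assms(1) this] have "(\<Sum>k<n. b k * y ^ k) \<noteq> 0"
    using P P_pos by blast
  then show False using assms(2) by simp
qed

text \<open>All places above w = c are proportional, with K independent of Q. Surjectivity of each
  place then forces Q y = 1, and all of them coincide with P.\<close>

lemma common_value:
  assumes "a \<noteq> 0"
  shows "\<exists>K. \<forall>Q. place F Q \<and> Q (w - c) > 0 \<longrightarrow> Q a = Q y * K"
proof -
  obtain b where b: "\<And>k. k < n \<Longrightarrow> b k \<in> W" "a = (\<Sum>k<n. b k * y ^ k)" using expansion by blast
  have "\<exists>k<n. b k \<noteq> 0"
  proof (rule ccontr)
    assume "\<not> ?thesis"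
    then have "a = 0" unfolding b(2) by (intro sum.neutral) auto
    then show False using assms by simp
  qed
  from expansion_value[OF b(1) this] show ?thesis unfolding b(2) by blast
qed

lemma value_y:
  assumes Q: "place F Q" "Q (w - c) > 0"
  shows "Q y = 1"
proof -
  obtain a where a: "Q a = 1" using Q(1) unfolding place_def by (metis surjD)
  then have "a \<noteq> 0" using Q(1) by auto
  from common_value[OF this] obtain K where "Q a = Q y * K" using Q by blast
  then show ?thesis using a above_c(1)[OF Q] by (simp add: pos_zmult_eq_1_iff)
qed

lemma place_unique:
  assumes Q: "place F Q" "Q (w - c) > 0"
  shows "Q = P"
proof
  fix a
  show "Q a = P a"
  proof (cases "a = 0")
    case False
    from common_value[OF this] obtain K where
      K: "\<forall>Q. place F Q \<and> Q (w - c) > 0 \<longrightarrow> Q a = Q y * K" by blast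
    have "R a = K" if "place F R" "R (w - c) > 0" for R
      using value_y[OF that] that K[rule_format, of R] by simp
    from this[OF Q] this[OF P P_pos] show ?thesis by simp
  qed (use P Q in simp)
qed

lemma P_values: "P y = 1" "P x = 3" "P w = 0" "P (w - c) = int n"
  using value_y[OF P P_pos] above_c[OF P P_pos] by simp_all

section \<open>Kummer automorphisms y \<mapsto> zy over W\<close>

definition kummer_aut :: "'k \<Rightarrow> 'k \<Rightarrow> 'k" where
  "kummer_aut z a = poly (SOME p. p \<in> polys W \<and> poly p y = a) (z * y)"

text \<open>The choice made by \<open>SOME\<close> is immaterial: the difference of two representing
  polynomials reduces modulo Y^n = y^n to zero coefficients, so it also vanishes at zy, another n-th
  root of y^n.\<close>

lemma kummer_aut_poly:
  assumes z: "z ^ n = 1" and p: "p \<in> polys W"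
  shows "kummer_aut z (poly p y) = poly p (z * y)"
proof -
  define r where "r = (SOME r. r \<in> polys W \<and> poly r y = poly p y)"
  have "r \<in> polys W \<and> poly r y = poly p y"
    unfolding r_def by (rule someI[of _ p]) (use p in simp)
  then have r: "r \<in> polys W" "poly r y = poly p y" by auto
  have "r - p \<in> polys W" using W_subring r p by (intro polysI)
  from poly_reduce_power[OF W_subring y_power_n_in_W n_pos this] obtain b where
    b: "\<forall>k<n. b k \<in> W" "\<forall>Y. Y ^ n = y ^ n \<longrightarrow> poly (r - p) Y = (\<Sum>k<n. b k * Y ^ k)"
    by (elim exE conjE)
  have b0: "(\<Sum>k<n. b k * y ^ k) = 0" using b(2)[rule_format, of y] r(2) by simp
  have "b k = 0" if "k < n" for k
    by (rule expansion_zero[of b, OF _ b0 that]) (use b(1) in blast)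
  then have "(\<Sum>k<n. b k * (z * y) ^ k) = 0" by (intro sum.neutral) auto
  moreover have "(z * y) ^ n = y ^ n" using z by (simp add: power_mult_distrib)
  then have "poly (r - p) (z * y) = (\<Sum>k<n. b k * (z * y) ^ k)" by (rule b(2)[rule_format])
  ultimately have "poly (r - p) (z * y) = 0" by simp
  then show ?thesis by (simp add: kummer_aut_def flip: r_def)
qed

lemma ex_poly: "\<exists>p\<in>polys W. a = poly p y"
  using UNIV_I[of a] unfolding adjoin_W_y[symmetric] adjoin_def by blast

lemma kummer_aut_hom:
  assumes z: "z ^ n = 1"
  shows "kummer_aut z (a + b) = kummer_aut z a + kummer_aut z b"
    and "kummer_aut z (a * b) = kummer_aut z a * kummer_aut z b"
proof -
  obtain p r where p: "p \<in> polys W" "a = poly p y" and r: "r \<in> polys W" "b = poly r y"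
    using ex_poly by meson
  have "kummer_aut z (poly (p + r) y) = poly (p + r) (z * y)"
    by (rule kummer_aut_poly[OF z polys_add[OF W_subring p(1) r(1)]])
  moreover have "kummer_aut z (poly (p * r) y) = poly (p * r) (z * y)"
    by (rule kummer_aut_poly[OF z polys_mult[OF W_subring p(1) r(1)]])
  ultimately show "kummer_aut z (a + b) = kummer_aut z a + kummer_aut z b"
    "kummer_aut z (a * b) = kummer_aut z a * kummer_aut z b"
    using p r by (simp_all add: kummer_aut_poly[OF z])
qed

lemma kummer_aut_W: "z ^ n = 1 \<Longrightarrow> a \<in> W \<Longrightarrow> kummer_aut z a = a"
  using kummer_aut_poly[of z "[:a:]"] W_subring by (simp add: polysI)

lemma kummer_aut_expansion:
  assumes z: "z ^ n = 1" and b: "\<And>k. k < n \<Longrightarrow> b k \<in> W"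
  shows "kummer_aut z (\<Sum>k<n. b k * y ^ k) = (\<Sum>k<n. b k * (z * y) ^ k)"
proof -
  have "(\<Sum>k<n. monom (b k) k) \<in> polys W"
    using W_subring b by (intro polys_sum polys_monom) auto
  from kummer_aut_poly[OF z this] show ?thesis by (simp add: poly_sum poly_monom)
qed

lemma kummer_aut_nonzero:
  assumes "z ^ n = 1" "a \<noteq> 0"
  shows "kummer_aut z a \<noteq> 0"
proof -
  have "kummer_aut z a * kummer_aut z (inverse a) = 1"
    using kummer_aut_hom(2)[OF assms(1), of a "inverse a"] assms(2)
      kummer_aut_W[OF assms(1) subring_1[OF W_subring]] by simp
  then show ?thesis by auto
qed

lemma surj_kummer_aut:
  assumes z: "z \<in> roots_of_unity_in F n"
  shows "surj (kummer_aut z)"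
proof -
  have z1: "z ^ n = 1" and zF: "z \<in> F" using z by (auto simp: roots_of_unity_in_def)
  then have z0: "z \<noteq> 0" using n_pos by (auto simp: power_0_left)
  have "\<exists>a'. a = kummer_aut z a'" for a
  proof -
    obtain b where b: "\<And>k. k < n \<Longrightarrow> b k \<in> W" "a = (\<Sum>k<n. b k * y ^ k)"
      using expansion by blast
    have "b k / z ^ k \<in> W" if "k < n" for k
      using b(1)[OF that] zF F_subset_W W_subring
      by (intro subfield_divide[OF W_subfield] subring_power) auto
    from kummer_aut_expansion[OF z1 this] have
      "kummer_aut z (\<Sum>k<n. b k / z ^ k * y ^ k) = a"
      unfolding b(2) using z0 by (simp add: power_mult_distrib)
    then show ?thesis by metis
  qed
  then show ?thesis by (simp add: surj_def)
qed

lemma place_kummer_aut: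
  assumes Q: "place F Q" and z: "z \<in> roots_of_unity_in F n"
  shows "place F (Q \<circ> kummer_aut z)"
proof -
  have z1: "z ^ n = 1" using z by (simp add: roots_of_unity_in_def)
  note hom = kummer_aut_hom[OF z1] and nz = kummer_aut_nonzero[OF z1]
  have "kummer_aut z 0 = 0"
    using kummer_aut_W[OF z1] subring_0[OF W_subring] by simp
  moreover have "surj (Q \<circ> kummer_aut z)"
    using Q surj_kummer_aut[OF z] by (intro comp_surj) (auto simp: place_def)
  moreover have "kummer_aut z a = a" if "a \<in> F" for a
    using kummer_aut_W[OF z1] F_subset_W that by blast
  moreover have "min (Q (kummer_aut z a)) (Q (kummer_aut z b)) \<le> Q (kummer_aut z (a + b))"
    if "a \<noteq> 0" "b \<noteq> 0" "a + b \<noteq> 0" for a b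
    using place_add[OF Q nz[OF that(1)] nz[OF that(2)]] nz[OF that(3)] unfolding hom(1) .
  ultimately show ?thesis
    unfolding place_def using Q by (simp add: hom(2) nz place_mult place_const)
qed

section \<open>Functions regular away from P\<close>

definition regular :: "'k \<Rightarrow> bool" where
  "regular a \<longleftrightarrow> (\<forall>Q. place F Q \<and> Q \<noteq> P \<longrightarrow> Q a \<ge> 0)"

lemma regularD: "regular a \<Longrightarrow> place F Q \<Longrightarrow> Q \<noteq> P \<Longrightarrow> Q a \<ge> 0"
  by (simp add: regular_def)

lemma regular_mult: "regular a \<Longrightarrow> regular b \<Longrightarrow> regular (a * b)"
  unfolding regular_def using place_mult_nonneg[of F _ a b] by blast

lemma regular_power: "regular a \<Longrightarrow> regular (a ^ k)"
  by (auto simp: regular_def place_power)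

lemma regular_sum:
  assumes "\<And>i. i \<in> I \<Longrightarrow> regular (f i)"
  shows "regular (sum f I)"
  unfolding regular_def
proof (intro allI impI)
  fix Q assume "place F Q \<and> Q \<noteq> P"
  then show "Q (sum f I) \<ge> 0"
    using regularD[OF assms, of _ Q] by (intro place_sum_nonneg[of F Q]) auto
qed

lemma regular_const: "a \<in> F \<Longrightarrow> regular a"
  by (auto simp: regular_def place_const)

text \<open>The automorphism fixes w - c, which vanishes at P only; so pulling back a place other
  than P never gives P.\<close>

lemma regular_kummer_aut:
  assumes a: "regular a" and z: "z \<in> roots_of_unity_in F n"
  shows "regular (kummer_aut z a)"
  unfolding regular_def
proof (intro allI impI)
  fix Q assume Q: "place F Q \<and> Q \<noteq> P"
  have "w - c \<in> W"
    by (rule subring_diff[OF W_subring w_in_W subsetD[OF F_subset_W c(1)]])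
  then have "kummer_aut z (w - c) = w - c"
    using z kummer_aut_W by (simp add: roots_of_unity_in_def)
  then have "Q (w - c) = (Q \<circ> kummer_aut z) (w - c)" by simp
  moreover have "\<not> Q (w - c) > 0" using place_unique[of Q] Q by blast
  ultimately have "Q \<circ> kummer_aut z \<noteq> P" using P_pos by auto
  then have "(Q \<circ> kummer_aut z) a \<ge> 0"
    using regularD[OF a place_kummer_aut[OF _ z]] Q by blast
  then show "Q (kummer_aut z a) \<ge> 0" by simp
qed

text \<open>Averaging over the Kummer group projects onto the i-th term; its order n equals q + 1, which
  is 1 in the field.\<close>
lemma regular_component:
  assumes b: "\<And>k. k < n \<Longrightarrow> b k \<in> W" and a: "regular (\<Sum>k<n. b k * y ^ k)" and i: "i < n"
  shows "regular (b i * y ^ i)"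
proof -
  let ?M = "roots_of_unity_in F n"
  have "card ?M = n"
    using card_roots_of_unity_in[OF F n_pos card_minus_1 card_gt_1] .
  note orth = sum_roots_of_unity_in_orthogonal[OF F this i]
  have M: "z ^ n = 1" "inverse z \<in> F" if "z \<in> ?M" for z
    using that F(1) by (auto simp: roots_of_unity_in_def is_subfield_def)
  have "(\<Sum>z\<in>?M. inverse z ^ i * kummer_aut z (\<Sum>k<n. b k * y ^ k))
      = (\<Sum>z\<in>?M. \<Sum>k<n. (inverse z ^ i * z ^ k) * (b k * y ^ k))"
  proof (intro sum.cong refl)
    fix z assume "z \<in> ?M"
    then have "kummer_aut z (\<Sum>k<n. b k * y ^ k) = (\<Sum>k<n. b k * (z * y) ^ k)"
      using M(1) b by (intro kummer_aut_expansion)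
    then show "inverse z ^ i * kummer_aut z (\<Sum>k<n. b k * y ^ k)
        = (\<Sum>k<n. (inverse z ^ i * z ^ k) * (b k * y ^ k))"
      by (simp add: sum_distrib_left power_mult_distrib ac_simps)
  qed
  also have "\<dots> = (\<Sum>k<n. (\<Sum>z\<in>?M. inverse z ^ i * z ^ k) * (b k * y ^ k))"
    unfolding sum_distrib_right by (rule sum.swap)
  also have "\<dots> = (\<Sum>k<n. if k = i then b k * y ^ k else 0)"
    using orth of_nat_n by (intro sum.cong) auto
  also have "\<dots> = b i * y ^ i" using i by simp
  finally have eq: "b i * y ^ i = (\<Sum>z\<in>?M. inverse z ^ i * kummer_aut z (\<Sum>k<n. b k * y ^ k))"
    by (rule sym)
  show ?thesis
    unfolding eq using a M
    by (intro regular_sum regular_mult regular_power) (auto intro: regular_const regular_kummer_aut)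
qed

section \<open>The Weierstrass semigroup\<close>

definition "f0 = inverse (w - c)"

text \<open>The possible value patterns, by the sign of Q x. The scale \<open>t\<close> is left
  open: later arguments use only its sign and the ratios between the values.\<close>

lemma place_cases:
  assumes Q: "place F Q" "Q \<noteq> P"
  obtains
    (pole) t where "t > 0" "Q x = - 3 * t" "Q w = - 3 * t" "Q y = - 2 * t" "Q (w - c) = - 3 * t"
  | (zero) t c' where "t > 0" "Q x = 3 * t" "Q w = 0" "Q y = t" "Q (w - c) = 0"
      "c' \<in> F" "Q (w - c') = int n * t"
  | (y_zero) t where "t > 0" "Q x = 0" "Q w = 3 * t" "Q y = t" "Q (w - c) = 0"
  | (other) "Q x = 0" "Q w = 0" "Q y = 0" "Q (w - c) = 0"
proof -
  have np: "\<not> Q (w - c) > 0" using place_unique[OF Q(1)] Q(2) by blast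
  have wc: "w - c \<noteq> 0" using P_pos P by auto
  have nonneg: "Q (w - c) = 0" if "Q w \<ge> 0"
  proof -
    have "Q (w - c) \<ge> 0"
      using place_add_nonneg[OF Q(1), of w "- c"] that place_uminus[OF Q(1), of c]
        place_const[OF Q(1) c(1)] by simp
    then show ?thesis using np by simp
  qed
  have y: "3 * Q y = Q x + Q w" using y_value[OF Q(1)] .
  have dom: "Q b = Q a" if "Q a < 0" "b ^ m = - (1 + a ^ m)" for a b
  proof -
    have "a \<noteq> 0" using that Q(1) by auto
    then have "Q (a ^ m + 1) = Q (a ^ m)"
      using that(1) m by (intro place_add_eq(2)[OF Q(1)])
        (auto simp: place_power[OF Q(1)] place_1[OF Q(1)] mult_less_0_iff)
    then have "Q (b ^ m) = Q (a ^ m)"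
      using that(2) place_uminus[OF Q(1), of "1 + a ^ m"] by (simp add: add.commute)
    then show ?thesis using m by (simp add: place_power[OF Q(1)])
  qed
  have wm: "w ^ m = - (1 + x ^ m)" and xm: "x ^ m = - (1 + w ^ m)"
    using fermat by (simp_all add: eq_neg_iff_add_eq_0 algebra_simps)
  consider "Q x < 0" | "Q x > 0" | "Q x = 0" by linarith
  then show ?thesis
  proof cases
    case 1
    have w: "Q w = Q x" using dom[OF 1 wm] .
    have "c \<noteq> 0" using c m by (auto simp: power_0_left)
    then have "Q (w - c) = Q w"
      using 1 w nonzero place_const[OF Q(1) c(1)]
        place_add_eq(2)[OF Q(1), of w "- c"] place_uminus[OF Q(1), of c] by simp
    \<comment> \<open>3 Q(y) = 2 Q(x) forces 3 to divide Q(x), so \<open>div\<close> is exact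
      here.\<close>
    moreover have "Q x = - 3 * (- (Q x div 3))" "Q y = - 2 * (- (Q x div 3))"
      using y w by presburger+
    ultimately show ?thesis
      using pole[of "- (Q x div 3)"] 1 w by simp
  next
    case 2
    from zero_of_x(4)[OF Q(1) 2] obtain c' where "c' \<in> F" "Q (w - c') = int n * Q y" by blast
    then show ?thesis
      using zero[of "Q y" c'] zero_of_x(1-3)[OF Q(1) 2] nonneg by simp
  next
    case 3
    have "Q w \<ge> 0" using dom[of w x, OF _ xm] 3 by force
    then consider "Q w > 0" | "Q w = 0" by linarith
    then show ?thesis
    proof cases
      case 1
      then show ?thesis using y_zero[of "Q y"] y 3 nonneg by simp
    next
      case 2
      then show ?thesis using other y 3 nonneg by simp
    qed
  qed
qed

lemma f0_nonzero: "f0 \<noteq> 0" and w_minus_c_nonzero: "w - c \<noteq> 0"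
  using P_pos P by (auto simp: f0_def)

lemma value_f0: "place F Q \<Longrightarrow> Q f0 = - Q (w - c)"
  by (simp add: f0_def place_inverse)

lemma value_x_f0: "place F Q \<Longrightarrow> Q (x * f0) = Q x - Q (w - c)"
  using nonzero f0_nonzero by (simp add: place_mult value_f0)

lemma value_y_f0: "place F Q \<Longrightarrow> Q (y * f0) = Q y - Q (w - c)"
  using nonzero f0_nonzero by (simp add: place_mult value_f0)

lemma regular_generators: "regular f0" "regular (x * f0)" "regular (y * f0)"
proof -
  have "Q f0 \<ge> 0 \<and> Q (x * f0) \<ge> 0 \<and> Q (y * f0) \<ge> 0" if Q: "place F Q" "Q \<noteq> P" for Q
    by (rule place_cases[OF Q]) (simp_all add: value_f0[OF Q(1)] value_x_f0[OF Q(1)] value_y_f0[OF Q(1)])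
  then show "regular f0" "regular (x * f0)" "regular (y * f0)" by (auto simp: regular_def)
qed

lemma P_generators: "P f0 = - int n" "P (x * f0) = - int (n - 3)" "P (y * f0) = - int (n - 1)"
  using m n_def by (simp_all add: value_f0[OF P] value_x_f0[OF P] value_y_f0[OF P] P_values)

lemma regular_in_W:
  assumes z: "z \<in> W" "z \<noteq> 0" "regular z"
  shows "\<exists>j::nat. P z = - int (j * n)"
proof -
  obtain j where "\<forall>v. place F v \<and> v (w - c) > 0 \<longrightarrow> v z = j * v (w - c)"
    using place_ratfun[OF F(1) c(1) z(1,2)] by (rule exE)
  from this[rule_format, of P] have j: "P z = j * int n" using P P_pos P_values(4) by simp
  have "\<not> P z > 0"
  proof
    assume pos: "P z > 0"
    then obtain Q where Q: "place F Q" "Q z < 0" using ex_pole_of_zero[OF P] by blast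
    then show False using regularD[OF z(3) Q(1)] pos by (cases "Q = P") auto
  qed
  then have "j \<le> 0" using j n_pos by (simp add: zero_less_mult_iff)
  then show ?thesis using j by (intro exI[of _ "nat (- j)"]) simp
qed

lemma regular_term:
  assumes b: "b \<in> W" "b \<noteq> 0" and i: "i < n" and reg: "regular (b * y ^ i)"
  shows "\<exists>j s k. P (b * y ^ i) = - int (s * (n - 3) + k * (n - 1) + j * n)"
proof -
  define s k where "s = i div 3" and "k = i mod 3"
  have ik: "i = 3 * s + k" "k < 3" by (simp_all add: s_def k_def)
  \<comment> \<open>y^(3s) = x^s w^s, so dividing by (x f0)^s (y f0)^k removes both x and y and
    leaves an element of W.\<close>
  define z where "z = b * w ^ s * (w - c) ^ (s + k)"
  have z0: "z \<noteq> 0" using b nonzero w_minus_c_nonzero by (simp add: z_def)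
  have "w - c \<in> W" by (rule subring_diff[OF W_subring w_in_W subsetD[OF F_subset_W c(1)]])
  then have zW: "z \<in> W"
    unfolding z_def using W_subring b(1) w_in_W by (intro subring_mult subring_power)
  have "(w - c) ^ (s + k) * f0 ^ (s + k) = 1"
    using w_minus_c_nonzero by (simp add: f0_def flip: power_mult_distrib)
  moreover have "y ^ i = x ^ s * w ^ s * y ^ k"
    by (simp add: ik power_add power_mult y3 power_mult_distrib)
  moreover have "z * ((x * f0) ^ s * (y * f0) ^ k)
      = b * (x ^ s * w ^ s * y ^ k) * ((w - c) ^ (s + k) * f0 ^ (s + k))"
    by (simp add: z_def power_mult_distrib power_add mult_ac)
  ultimately have dec: "b * y ^ i = z * ((x * f0) ^ s * (y * f0) ^ k)" by simp
  have val: "Q (b * y ^ i) = Q z + int s * Q (x * f0) + int k * Q (y * f0)" if "place F Q" for Q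
    unfolding dec using that z0 nonzero f0_nonzero by (simp add: place_mult place_power)
  have "regular z"
    unfolding regular_def
  proof (intro allI impI)
    fix Q assume "place F Q \<and> Q \<noteq> P"
    then have Q: "place F Q" "Q \<noteq> P" by auto
    have ge: "Q z + int s * Q (x * f0) + int k * Q (y * f0) \<ge> 0"
      using regularD[OF reg Q] val[OF Q(1)] by simp
    from Q show "Q z \<ge> 0"
    proof (cases rule: place_cases)
      \<comment> \<open>Here x f0 has value 0 and y f0 has value t, so Q z \<ge> -k t > -3t, while Q
        z is a multiple of 3t.\<close>
      case (pole t)
      obtain j where "Q z = j * Q w"
        using place_ratfun_pole[OF F(1) zW z0 Q(1)] pole by auto
      then have mult: "Q z = (- j) * (3 * t)" using pole by simp
      have lt: "int k * t < 3 * t" using ik pole by simp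
      have "Q z + int k * t \<ge> 0"
        using ge pole by (simp add: value_x_f0[OF Q(1)] value_y_f0[OF Q(1)])
      then show ?thesis using pole(1) lt by (intro int_multiple_nonneg[OF _ mult]) linarith+
    next
      \<comment> \<open>The generators contribute 3s t + k t = i t < n t, and values on W are
        multiples of n t.\<close>
      case (zero t c')
      have pos: "int n * t > 0" using zero n_pos by simp
      obtain j where "\<forall>v. place F v \<and> v (w - c') > 0 \<longrightarrow> v z = j * v (w - c')"
        using place_ratfun[OF F(1) zero(6) zW z0] by (rule exE)
      from this[rule_format, of Q] have "Q z = j * Q (w - c')" using Q(1) pos zero(7) by simp
      then have mult: "Q z = j * (int n * t)" using zero by simp
      have lt: "int i * t < int n * t" using i zero by simp
      have "Q z + int i * t \<ge> 0"
        using ge zero by (simp add: value_x_f0[OF Q(1)] value_y_f0[OF Q(1)] ik algebra_simps)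
      then show ?thesis using pos lt by (intro int_multiple_nonneg[OF _ mult]) linarith+
    next
      \<comment> \<open>The bound is again k t < 3t, now with w itself as the local parameter on
        W.\<close>
      case (y_zero t)
      obtain j where "\<forall>v. place F v \<and> v (w - 0) > 0 \<longrightarrow> v z = j * v (w - 0)"
        using place_ratfun[OF F(1) subring_0[OF subfield_subring[OF F(1)]] zW z0] by (rule exE)
      from this[rule_format, of Q] have "Q z = j * Q w" using Q(1) y_zero(1,3) by simp
      then have mult: "Q z = j * (3 * t)" using y_zero by simp
      have lt: "int k * t < 3 * t" using ik y_zero by simp
      have "Q z + int k * t \<ge> 0"
        using ge y_zero by (simp add: value_x_f0[OF Q(1)] value_y_f0[OF Q(1)])
      then show ?thesis using y_zero(1) lt by (intro int_multiple_nonneg[OF _ mult]) linarith+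
    next
      case other
      then show ?thesis using ge by (simp add: value_x_f0[OF Q(1)] value_y_f0[OF Q(1)])
    qed
  qed
  then obtain j :: nat where "P z = - int (j * n)" using regular_in_W[OF zW z0] by blast
  then have "P (b * y ^ i) = - int (s * (n - 3) + k * (n - 1) + j * n)"
    unfolding val[OF P] P_generators by simp
  then show ?thesis by blast
qed

lemma semigroup:
  "weierstrass_semigroup F P = {a * (n - 3) + b * (n - 1) + d * n | a b d. True}" (is "_ = ?R")
proof (intro equalityI subsetI)
  fix N assume "N \<in> weierstrass_semigroup F P"
  then obtain a where a: "a \<noteq> 0" "P a = - int N" "regular a"
    by (auto simp: weierstrass_semigroup_def regular_def)
  obtain b where b: "\<And>k. k < n \<Longrightarrow> b k \<in> W" "a = (\<Sum>k<n. b k * y ^ k)" using expansion by blast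
  have "\<exists>k<n. b k \<noteq> 0"
  proof (rule ccontr)
    assume "\<not> ?thesis"
    then have "a = 0" unfolding b(2) by (intro sum.neutral) auto
    then show False using a by simp
  qed
  from expansion_value[OF b(1) this] obtain i where i: "i < n" "b i \<noteq> 0" "P (b i * y ^ i) = P a"
    unfolding b(2) using P P_pos by auto
  have "regular (b i * y ^ i)"
    by (rule regular_component[of b, OF b(1) a(3)[unfolded b(2)] i(1)])
  from regular_term[OF b(1)[OF i(1)] i(2,1) this] obtain j s k
    where "- int N = - int (s * (n - 3) + k * (n - 1) + j * n)"
    using i(3) a(2) by auto
  then have "N = s * (n - 3) + k * (n - 1) + j * n" by linarith
  then show "N \<in> ?R" by blast
next
  fix N assume "N \<in> ?R"
  then obtain a b d where N: "N = a * (n - 3) + b * (n - 1) + d * n" by blast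
  let ?g = "(x * f0) ^ a * (y * f0) ^ b * f0 ^ d"
  have "?g \<noteq> 0" using nonzero f0_nonzero by simp
  moreover have "P ?g = - int N"
    using nonzero f0_nonzero P_generators
    by (simp add: place_mult[OF P, of "(x * f0) ^ a * (y * f0) ^ b"] place_mult[OF P, of "(x * f0) ^ a"]
        place_power[OF P] N)
  moreover have "regular ?g"
    by (intro regular_mult regular_power regular_generators)
  ultimately show "N \<in> weierstrass_semigroup F P"
    unfolding weierstrass_semigroup_def regular_def by blast
qed

end

section \<open>Reduction of all points of O to zeros of x\<close>

lemma semigroup_at_zero:
  fixes F :: "'k::field set" and x y w :: 'k
  assumes curve: "kummer_curve F x y w m n" and P: "place F P" "P x > 0"
  shows "weierstrass_semigroup F P = {a * (n - 3) + b * (n - 1) + d * n | a b d. True}"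
proof -
  interpret kummer_curve F x y w m n by (rule curve)
  obtain c where c: "c \<in> F" "c ^ m + 1 = 0" "P (w - c) = int n * P y" using zero_of_x(4)[OF P] by blast
  then have "P (w - c) > 0" using n_pos zero_of_x(2)[OF P] by simp
  then interpret kummer_point F x y w m n c P by unfold_locales (use P c in auto)
  show ?thesis by (rule semigroup)
qed

theorem theorem4p2:
  fixes q :: nat and F :: "'k::field set" and x y :: 'k and P :: "'k \<Rightarrow> int"
  assumes "prime_power_nat q" and "q \<ge> 5" and "q mod 3 = 2"
    and "is_subfield F" and "finite F" and "card F = q ^ 2"
    and "transcendental_over F x"
    and "generated_by F x y"
    and "y ^ (q + 1) + x ^ (2 * ((q + 1) div 3)) + x ^ ((q + 1) div 3) = 0"
    and "P \<in> O_set F ((q + 1) div 3) x y"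
  shows "weierstrass_semigroup F P = {a * (q - 2) + b * q + c * (q + 1) | a b c. True}"
proof -
  define m n where "m = (q + 1) div 3" and "n = q + 1"
  have n: "n = 3 * m" and m: "m > 1" using assms(2,3) unfolding m_def n_def by presburger+
  have P: "place F P"
    using assms(10) by (auto simp: O_set_def O_zero_def O_infty_def O_m_def)
  note R = subfield_subring[OF assms(4)]
  have xF: "x - a \<noteq> 0" if "a \<in> F" for a
  proof -
    have "coeff [:- a, 1:] i \<in> F" for i
      using that R polys_coeff[of "[:- a, 1:]" F i] by (simp add: polysI polys_pCons subringD)
    moreover have "[:- a, 1:] \<noteq> 0" by simp
    ultimately have "poly [:- a, 1:] x \<noteq> 0" using assms(7) unfolding transcendental_over_def by blast
    then show ?thesis by simp
  qed
  have x: "x \<noteq> 0" using xF[of 0] subring_0[OF R] by simp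
  define w where "w = y ^ 3 / x"
  have y3: "y ^ 3 = x * w" using x by (simp add: w_def)
  have "y ^ n = x ^ m * w ^ m" by (simp add: n power_mult y3 power_mult_distrib)
  \<comment> \<open>The equation of the curve is x^m times the Fermat equation in w and x.\<close>
  then have "x ^ m * (w ^ m + x ^ m + 1) = 0"
    using assms(9)[folded m_def, folded n_def]
    by (simp add: algebra_simps power_mult power2_eq_square mult_2 power_add)
  then have fermat: "w ^ m + x ^ m + 1 = 0" using x by simp
  \<comment> \<open>Otherwise x would be a root of X^m + 1, against transcendence.\<close>
  have w: "w \<noteq> 0"
  proof
    assume "w = 0"
    then have xm: "x ^ m + 1 = 0" using fermat m by (simp add: power_0_left)
    have "monom 1 m + [:1:] \<in> polys F" using R by (intro polysI subring_1)
    then have "\<forall>i. coeff (monom 1 m + [:1:]) i \<in> F" by (auto simp: polys_def)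
    moreover have "coeff (monom (1::'k) m + [:1:]) 0 = 1" using m by simp
    then have "monom (1::'k) m + [:1:] \<noteq> 0" by force
    ultimately have "poly (monom 1 m + [:1:]) x \<noteq> 0"
      using assms(7) unfolding transcendental_over_def by blast
    then show False using xm by (simp add: poly_monom)
  qed
  then have y: "y \<noteq> 0" using y3 x by auto
  have card: "card F = (n - 1) ^ 2" using assms(6) by (simp add: n_def)
  have gen: "generated_by F x' y'"
    if "\<And>S. is_subfield S \<Longrightarrow> F \<subseteq> S \<Longrightarrow> x' \<in> S \<Longrightarrow> y' \<in> S \<Longrightarrow> x \<in> S \<and> y \<in> S" for x' y'
    using assms(8) that unfolding generated_by_def by blast
  have S: "a * b \<in> S" "a / b \<in> S" "inverse a \<in> S" "a ^ k \<in> S" if "is_subfield S" "a \<in> S" "b \<in> S" for S and a b :: 'k and k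
    using that subfield_divide[OF that] subring_power[OF subfield_subring[OF that(1)]]
    by (auto simp: is_subfield_def)
  have "\<exists>x' y' w'. kummer_curve F x' y' w' m n \<and> P x' > 0"
  proof -
    consider "P x > 0" | "P x < 0" | a where "a \<in> F" "a ^ m + 1 = 0" "P (x - a) > 0" "P y > 0"
      using assms(10) unfolding O_set_def O_zero_def O_infty_def O_m_def m_def[symmetric] by blast
    then show ?thesis
    proof cases
      case 1
      have "kummer_curve F x y w m n"
        by unfold_locales (use assms card m n x y w y3 fermat in auto)
      then show ?thesis using 1 by blast
    next
      case 2
      \<comment> \<open>Dividing the Fermat equation by x^m exchanges poles and zeros of x.\<close>
      have "kummer_curve F (inverse x) (y / x) (w / x) m n"
      proof unfold_locales
        show "generated_by F (inverse x) (y / x)"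
        proof (rule gen)
          fix T assume T: "is_subfield T" "inverse x \<in> T" "y / x \<in> T"
          then have "x \<in> T" using S(3)[OF T(1,2,2)] by simp
          moreover have "y = y / x * x" using x by simp
          then have "y \<in> T" using S(1)[OF T(1,3) \<open>x \<in> T\<close>] by simp
          ultimately show "x \<in> T \<and> y \<in> T" by simp
        qed
        show "(y / x) ^ 3 = inverse x * (w / x)"
          using x y3 by (simp add: field_simps power3_eq_cube)
        have "(w / x) ^ m + inverse x ^ m + 1 = (w ^ m + x ^ m + 1) / x ^ m"
          using x by (simp add: power_divide power_inverse field_simps)
        then show "(w / x) ^ m + inverse x ^ m + 1 = 0" using fermat by simp
      qed (use assms card m n x y w in auto)
      moreover have "P (inverse x) > 0" using 2 by (simp add: place_inverse[OF P])
      ultimately show ?thesis by blast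
    next
      case (3 a)
      \<comment> \<open>At the points (a, 0) the function x is a unit, so w = y^3/x vanishes; the
        symmetry between x and w turns P into a zero of the new first coordinate.\<close>
      have "kummer_curve F w y x m n"
      proof unfold_locales
        show "generated_by F w y"
        proof (rule gen)
          fix T assume T: "is_subfield T" "w \<in> T" "y \<in> T"
          have "x = y ^ 3 / w" using y3 w by simp
          then show "x \<in> T \<and> y \<in> T" using S(2)[OF T(1) S(4)[OF T(1,3,3)] T(2)] T by simp
        qed
      qed (use assms card m n x y w y3 fermat in \<open>auto simp: mult.commute add_ac\<close>)
      moreover have "P w > 0"
      proof -
        have "a \<noteq> 0" using 3 m by (auto simp: power_0_left)
        have "x - a \<noteq> 0" using xF 3 by blast
        then have "P x = 0"
          using place_add_eq(2)[OF P \<open>a \<noteq> 0\<close>, of "x - a"] 3 place_const[OF P 3(1)] by simp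
        then show ?thesis
          unfolding w_def using 3 x y by (simp add: place_divide[OF P] place_power[OF P])
      qed
      ultimately show ?thesis by blast
    qed
  qed
  then have "weierstrass_semigroup F P = {a * (n - 3) + b * (n - 1) + d * n | a b d. True}"
    using semigroup_at_zero P by blast
  then show ?thesis by (simp add: n_def)
qed

end
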